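(* Let $2\le s\le r\le n-2$ and let $P=P(m_1,\dots,m_{n-1})$ be a natural unit interval order with $m_1=r$, $m_2=\cdots=m_s=n-1$ and $m_{s+1}=\cdots=m_{n-1}=n$; let $G=\mathrm{inc}(P)$. Then $$X_G(\mathbf{x},t)=[n-4]_t!\left\{\overline{C}_n(t)\,e_n+\overline{C}_{(n-1,1)}(t)\,e_{(n-1,1)}+\overline{C}_{(n-2,2)}(t)\,e_{(n-2,2)}\right\},$$ where $\overline{C}_n(t)=[n]_t[n-3]_t[r-1]_t[n-s-1]_t$, $\overline{C}_{(n-2,2)}(t)=t^{n+r-s-3}[2]_t[n-r-1]_t[s-1]_t$, and $\overline{C}_{(n-1,1)}(t)=\tfrac12[n-2]_t\left\{t^{r-1}(1+t^{n-r-s})[n-3]_t+t^{n-s-1}[2]_t[r-2]_t[s-1]_t+t^{r-1}[2]_t[n-r-1]_t[n-s-2]_t\right\}$. Moreover $X_G(\mathbf{x},t)$ is $e$-positive and $e$-unimodal with center of symmetry $\frac{\binom{n}{2}-(n-r+s-1)}{2}$.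
   Context: A natural unit interval order $P(m_1,\dots,m_{n-1})$ is defined for integers $m_1\le\cdots\le m_{n-1}\le n$ with $m_i\ge i$: it is the poset on $[n]$ with $i<_P j$ iff $i<n$ and $j\in\{m_i+1,\dots,n\}$. Its incomparability graph has vertex set $[n]$ and an edge $\{i,j\}$ ($i<j$) iff $j\le m_i$. The chromatic quasisymmetric function of a graph $G$ on $V\subset\mathbb{P}$ is $X_G(\mathbf{x},t)=\sum_\kappa t^{\mathrm{asc}(\kappa)}\prod_v x_{\kappa(v)}$ over proper colorings $\kappa:V\to\mathbb{P}$, with $\mathrm{asc}(\kappa)$ the number of edges $\{i,j\}$, $i<j$, with $\kappa(i)<\kappa(j)$. $[m]_t=1+t+\cdots+t^{m-1}$, $[m]_t!=[1]_t\cdots[m]_t$, $[0]_t!=1$; $e_\lambda$ denotes elementary symmetric functions. Writing $X_G(\mathbf{x},t)=\sum_{i=0}^m a_i(\mathbf{x})t^i$ with symmetric functions $a_i$, $X_G$ is $e$-positive if each $a_i$ is a nonnegative combination of the $e_\lambda$, and $e$-unimodal with center of symmetry $c$ if it is palindromic about $c$ ($a_i=a_{2c-i}$) and $a_{i+1}-a_i$ is $e$-positive for $0\le i<c$ (equivalently here, every coefficient of $e_\lambda$ is a unimodal polynomial with nonnegative coefficients, palindromic with center $c$). *)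

theory Defs
  imports "HOL-Library.FuncSet" "HOL-Computational_Algebra.Polynomial"
begin

(* Formal power series in the variables x_0, x_1, x_2, ... (x_k plays the role of the
   paper's x_{k+1}); a series is given by its coefficient function on monomials,
   a monomial being an exponent vector nat => nat (finitely supported ones matter). *)
type_synonym 'a series = "(nat \<Rightarrow> nat) \<Rightarrow> 'a"

definition ser_one :: "'a::comm_semiring_1 series" where
  "ser_one \<alpha> = (if \<alpha> = (\<lambda>_. 0) then 1 else 0)"

definition ser_mult :: "'a::comm_semiring_1 series \<Rightarrow> 'a series \<Rightarrow> 'a series" where
  "ser_mult f g \<alpha> = (\<Sum>\<beta> \<in> {\<beta>. \<forall>i. \<beta> i \<le> \<alpha> i}. f \<beta> * g (\<lambda>i. \<alpha> i - \<beta> i))"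

definition elem :: "nat \<Rightarrow> 'a::comm_semiring_1 series" where
  "elem k \<alpha> = (if (\<forall>i. \<alpha> i \<le> 1) \<and> finite {i. \<alpha> i \<noteq> 0} \<and> card {i. \<alpha> i = 1} = k
                then 1 else 0)"

definition elem_part :: "nat list \<Rightarrow> 'a::comm_semiring_1 series" where
  "elem_part lam = foldr ser_mult (map elem lam) ser_one"

definition is_partition :: "nat list \<Rightarrow> bool" where
  "is_partition lam \<longleftrightarrow> sorted (rev lam) \<and> (\<forall>k \<in> set lam. 0 < k)"

definition e_pos :: "rat series \<Rightarrow> bool" where
  "e_pos f \<longleftrightarrow> (\<exists>L c. finite L \<and> (\<forall>lam \<in> L. is_partition lam \<and> c lam \<ge> 0) \<and>
       f = (\<lambda>\<alpha>. \<Sum>lam \<in> L. c lam * elem_part lam \<alpha>))"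

definition tcoeff :: "rat poly series \<Rightarrow> nat \<Rightarrow> rat series" where
  "tcoeff X i = (\<lambda>\<alpha>. coeff (X \<alpha>) i)"

definition e_positive :: "rat poly series \<Rightarrow> bool" where
  "e_positive X \<longleftrightarrow> (\<forall>i. e_pos (tcoeff X i))"

(* palindromic with center c (a_i = a_{2c-i}, with a_j = 0 for j < 0) and
   a_{i+1} - a_i e-positive for 0 <= i < c *)
definition e_unimodal :: "rat poly series \<Rightarrow> rat \<Rightarrow> bool" where
  "e_unimodal X c \<longleftrightarrow> (\<exists>d::nat. of_nat d = 2 * c \<and>
      (\<forall>i. tcoeff X i = (if i \<le> d then tcoeff X (d - i) else (\<lambda>_. 0))) \<and>
      (\<forall>i. of_nat i < c \<longrightarrow> e_pos (\<lambda>\<alpha>. tcoeff X (Suc i) \<alpha> - tcoeff X i \<alpha>)))"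

(* chromatic quasisymmetric function of a graph on a finite vertex set V of naturals
   with edge relation E; colours are natural numbers (colour k <-> variable x_k) *)
definition asc :: "nat set \<Rightarrow> (nat \<Rightarrow> nat \<Rightarrow> bool) \<Rightarrow> (nat \<Rightarrow> nat) \<Rightarrow> nat" where
  "asc V E \<kappa> = card {(i, j). i \<in> V \<and> j \<in> V \<and> i < j \<and> E i j \<and> \<kappa> i < \<kappa> j}"

definition proper_col :: "nat set \<Rightarrow> (nat \<Rightarrow> nat \<Rightarrow> bool) \<Rightarrow> (nat \<Rightarrow> nat) \<Rightarrow> bool" where
  "proper_col V E \<kappa> \<longleftrightarrow> (\<forall>i \<in> V. \<forall>j \<in> V. E i j \<longrightarrow> \<kappa> i \<noteq> \<kappa> j)"

definition chrom_qsf :: "nat set \<Rightarrow> (nat \<Rightarrow> nat \<Rightarrow> bool) \<Rightarrow> rat poly series" where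
  "chrom_qsf V E \<alpha> =
     (\<Sum>\<kappa> \<in> {\<kappa>. \<kappa> \<in> V \<rightarrow>\<^sub>E UNIV \<and> proper_col V E \<kappa> \<and>
                  (\<forall>c. card {v \<in> V. \<kappa> v = c} = \<alpha> c)}.
        [:0, 1:] ^ asc V E \<kappa>)"

definition nuio_less :: "nat \<Rightarrow> (nat \<Rightarrow> nat) \<Rightarrow> nat \<Rightarrow> nat \<Rightarrow> bool" where
  "nuio_less n m i j \<longleftrightarrow> i \<in> {1..n} \<and> j \<in> {1..n} \<and> i < n \<and> m i < j"

definition inc_edge :: "nat \<Rightarrow> (nat \<Rightarrow> nat) \<Rightarrow> nat \<Rightarrow> nat \<Rightarrow> bool" where
  "inc_edge n m i j \<longleftrightarrow> i \<noteq> j \<and> \<not> nuio_less n m i j \<and> \<not> nuio_less n m j i"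

definition qint :: "nat \<Rightarrow> rat poly" where
  "qint k = (\<Sum>i<k. [:0, 1:] ^ i)"

definition qfact :: "nat \<Rightarrow> rat poly" where
  "qfact k = (\<Prod>i = 1..k. qint i)"

end

theory Submission
  imports Defs
begin

text \<open>
  The vertices of \<open>G\<close> form five consecutive cliques \<open>{1}\<close>, \<open>{2..s}\<close>, \<open>{s+1..r}\<close>, \<open>{r+1..n-1}\<close>, \<open>{n}\<close>, and two
  vertices are adjacent iff the indices of their cliques differ by at most two; every vertex subset inherits
  this structure. For each of them, on \<open>N\<close> vertices,
  \[X = [N]_t!\,e_N + \pi\,[N-2]_t!\,(e_{N-1,1} - [N]_t e_N)
      + \mu\,[N-4]_t!\,([2]_t e_{N-2,2} - [2]_t [N-2]_t e_{N-1,1} + t [N]_t [N-3]_t e_N),\]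
  where \<open>\<pi>\<close> and \<open>\<mu>\<close> are weighted counts of the non-edges and of the pairs of disjoint non-edges. Both sides
  obey the same recursion when the largest colour is removed: on the left its class is a vertex or a non-edge,
  on the right \<open>e\<^sub>k e\<^sub>l\<close> obeys a Leibniz rule, and everything reduces to how \<open>1\<close>, \<open>\<pi>\<close> and \<open>\<mu>\<close> behave
  under the removal of one or two vertices. With these combinations as basis the recursion also holds for
  small \<open>N\<close>, where some of the \<open>e\<^sub>\<lambda>\<close> above coincide.
\<close>

subsection \<open>The \<open>t\<close>-integers\<close>

definition t :: "rat poly" where
  "t = [:0, 1:]"

lemma t_neq_0 [simp]: "t \<noteq> 0"
  by (simp add: t_def)

lemma qint_eq_sum_t: "qint k = (\<Sum>i<k. t ^ i)"
  by (simp add: qint_def t_def)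

lemma qint_0 [simp]: "qint 0 = 0"
  by (simp add: qint_eq_sum_t)

lemma qint_1 [simp]: "qint 1 = 1" "qint (Suc 0) = 1"
  by (simp_all add: qint_eq_sum_t)

lemma qint_add: "qint (a + b) = qint a + t ^ a * qint b"
  by (induction b) (simp_all add: qint_eq_sum_t power_add algebra_simps)

lemma qint_Suc: "qint (Suc k) = 1 + t * qint k"
  using qint_add[of 1 k] by simp

lemma qint_2: "qint 2 = 1 + t"
  by (simp add: qint_Suc numeral_2_eq_2)

lemma power_t_eq_qint: "t ^ k = 1 + (t - 1) * qint k"
  using qint_add[of k 1] qint_Suc[of k] by (simp add: algebra_simps)

lemma qfact_0 [simp]: "qfact 0 = 1"
  by (simp add: qfact_def)

lemma qfact_Suc [simp]: "qfact (Suc k) = qint (Suc k) * qfact k"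
  by (simp add: qfact_def mult.commute)

lemma qint_mult_qint: "qint (Suc k) * qint (Suc m) = qint (Suc (k + m)) + t * (qint k * qint m)"
  unfolding qint_Suc qint_add power_t_eq_qint by algebra

lemma coeff_t_mult: "coeff (t * p) i = (if i = 0 then 0 else coeff p (i - 1))"
  by (cases i) (simp_all add: t_def)

lemma coeff_qint: "coeff (qint k) i = (if i < k then 1 else 0)"
proof (induction k arbitrary: i)
  case (Suc k)
  then show ?case by (cases i) (simp_all add: qint_Suc coeff_t_mult)
qed simp

lemma sum_power_t_rank:
  fixes W :: "nat set"
  assumes "finite W"
  shows "(\<Sum>v\<in>W. t ^ card {i \<in> W. i < v}) = qint (card W)"
  using assms
proof (induction rule: finite_linorder_max_induct)
  case (insert x W)
  have "{i \<in> insert x W. i < v} = {i \<in> W. i < v}" if "v \<in> W" for v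
    using insert.hyps(2) that by force
  moreover have "{i \<in> insert x W. i < x} = W" "x \<notin> W"
    using insert.hyps(2) by auto
  ultimately show ?case
    using insert by (simp add: qint_eq_sum_t)
qed simp

subsection \<open>Products of elementary symmetric functions\<close>

lemma ser_mult_fun_upd:
  assumes "\<alpha> c = 0"
  shows "ser_mult f g (\<alpha>(c := m)) =
    (\<Sum>i\<le>m. ser_mult (\<lambda>\<beta>. f (\<beta>(c := i))) (\<lambda>\<beta>. g (\<beta>(c := m - i))) \<alpha>)"
proof -
  let ?below = "\<lambda>\<alpha>. {\<beta>. \<forall>j. \<beta> j \<le> (\<alpha> j :: nat)}"
  have "ser_mult f g (\<alpha>(c := m)) =
      (\<Sum>(i, \<beta>)\<in>{..m} \<times> ?below \<alpha>. f (\<beta>(c := i)) * g ((\<lambda>j. \<alpha> j - \<beta> j)(c := m - i)))"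
    unfolding ser_mult_def
  proof (rule sum.reindex_bij_witness[where i = "\<lambda>(i, \<beta>). \<beta>(c := i)" and j = "\<lambda>\<beta>. (\<beta> c, \<beta>(c := 0))"])
    fix \<beta> assume "\<beta> \<in> ?below (\<alpha>(c := m))"
    then have \<beta>: "\<beta> j \<le> (if j = c then m else \<alpha> j)" for j
      by (simp add: fun_upd_def)
    have "\<beta> c \<le> m" "(\<beta>(c := 0)) j \<le> \<alpha> j" for j
      using \<beta>[of c] \<beta>[of j] by (cases "j = c"; simp)+
    then show "(\<beta> c, \<beta>(c := 0)) \<in> {..m} \<times> ?below \<alpha>"
      by simp
    have "(\<lambda>j. \<alpha> j - (\<beta>(c := 0)) j)(c := m - \<beta> c) = (\<lambda>j. (\<alpha>(c := m)) j - \<beta> j)"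
      by auto
    then show "(case (\<beta> c, \<beta>(c := 0)) of (i, \<beta>) \<Rightarrow> f (\<beta>(c := i)) * g ((\<lambda>j. \<alpha> j - \<beta> j)(c := m - i)))
        = f \<beta> * g (\<lambda>j. (\<alpha>(c := m)) j - \<beta> j)"
      by simp
  next
    fix p assume "p \<in> {..m} \<times> ?below \<alpha>"
    then obtain i \<beta> where p: "p = (i, \<beta>)" "i \<le> m" "\<And>j. \<beta> j \<le> \<alpha> j"
      by auto
    with assms have "\<beta> c = 0"
      by (metis le_zero_eq)
    with p show "(\<lambda>\<beta>. (\<beta> c, \<beta>(c := 0))) ((\<lambda>(i, \<beta>). \<beta>(c := i)) p) = p"
      "(\<lambda>(i, \<beta>). \<beta>(c := i)) p \<in> ?below (\<alpha>(c := m))"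
      by (auto simp: fun_upd_idem)
  qed auto
  then show ?thesis
    by (simp add: ser_mult_def sum.cartesian_product)
qed

lemma ser_mult_cong:
  assumes "\<And>\<beta>. \<forall>i. \<beta> i \<le> \<alpha> i \<Longrightarrow> f \<beta> = f' \<beta>" "\<And>\<beta>. \<forall>i. \<beta> i \<le> \<alpha> i \<Longrightarrow> g \<beta> = g' \<beta>"
  shows "ser_mult f g \<alpha> = ser_mult f' g' \<alpha>"
  unfolding ser_mult_def using assms by (intro sum.cong) auto

lemma ser_mult_zero [simp]: "ser_mult (\<lambda>_. 0) g \<alpha> = 0" "ser_mult f (\<lambda>_. 0) \<alpha> = 0"
  by (simp_all add: ser_mult_def)

lemma elem_fun_upd_1:
  assumes "\<beta> c = 0"
  shows "elem k (\<beta>(c := 1)) = (if k = 0 then 0 else elem (k - 1) \<beta>)"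
proof -
  have "{i. (\<beta>(c := 1)) i \<noteq> 0} = insert c {i. \<beta> i \<noteq> 0}" "{i. (\<beta>(c := 1)) i = 1} = insert c {i. \<beta> i = 1}"
    by auto
  moreover have "finite {i. \<beta> i = 1}" if "finite {i. \<beta> i \<noteq> 0}"
    by (rule finite_subset[OF _ that]) auto
  moreover have "(\<forall>i. (\<beta>(c := 1)) i \<le> 1) \<longleftrightarrow> (\<forall>i. \<beta> i \<le> 1)"
    using assms by (metis fun_upd_apply le_refl zero_le)
  ultimately have "(\<forall>i. (\<beta>(c := 1)) i \<le> 1) \<and> finite {i. (\<beta>(c := 1)) i \<noteq> 0} \<and> card {i. (\<beta>(c := 1)) i = 1} = k
    \<longleftrightarrow> k \<noteq> 0 \<and> (\<forall>i. \<beta> i \<le> 1) \<and> finite {i. \<beta> i \<noteq> 0} \<and> card {i. \<beta> i = 1} = k - 1"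
    using assms by (auto split: if_splits)
  then show ?thesis
    unfolding elem_def by simp
qed

lemma elem_fun_upd_ge_2: "2 \<le> m \<Longrightarrow> elem k (\<beta>(c := m)) = 0"
  by (auto simp: elem_def intro!: exI[of _ c])

lemma elem_0: "elem 0 = ser_one"
proof
  fix \<alpha> :: "nat \<Rightarrow> nat"
  have "finite {i. \<alpha> i = 1}" if "finite {i. \<alpha> i \<noteq> 0}"
    by (rule finite_subset[OF _ that]) auto
  then have "(\<forall>i. \<alpha> i \<le> 1) \<and> finite {i. \<alpha> i \<noteq> 0} \<and> card {i. \<alpha> i = 1} = 0 \<longleftrightarrow> \<alpha> = (\<lambda>_. 0)"
    by (auto simp: fun_eq_iff le_Suc_eq)
  then show "elem 0 \<alpha> = (ser_one \<alpha> :: 'a)"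
    unfolding elem_def ser_one_def by simp
qed

lemma elem_infinite_support: "infinite {i. \<alpha> i \<noteq> 0} \<Longrightarrow> elem k \<alpha> = 0"
  by (simp add: elem_def)

lemma finite_pointwise_le:
  assumes "finite {i. \<alpha> i \<noteq> (0 :: nat)}"
  shows "finite {\<beta>. \<forall>i. \<beta> i \<le> \<alpha> i}"
proof -
  let ?S = "{i. \<alpha> i \<noteq> 0}"
  have "finite (Pi\<^sub>E ?S (\<lambda>i. {..\<alpha> i}))"
    using assms by (intro finite_PiE) auto
  moreover have "inj_on (\<lambda>\<beta>. restrict \<beta> ?S) {\<beta>. \<forall>i. \<beta> i \<le> \<alpha> i}"
  proof (intro inj_onI ext)
    fix \<beta> \<gamma> i
    assume "\<beta> \<in> {\<beta>. \<forall>i. \<beta> i \<le> \<alpha> i}" "\<gamma> \<in> {\<beta>. \<forall>i. \<beta> i \<le> \<alpha> i}" "restrict \<beta> ?S = restrict \<gamma> ?S"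
    then show "\<beta> i = \<gamma> i"
      by (cases "\<alpha> i = 0") (simp_all add: restrict_def fun_eq_iff, metis le_zero_eq, metis neq0_conv)
  qed
  moreover have "(\<lambda>\<beta>. restrict \<beta> ?S) ` {\<beta>. \<forall>i. \<beta> i \<le> \<alpha> i} \<subseteq> Pi\<^sub>E ?S (\<lambda>i. {..\<alpha> i})"
    by (intro image_subsetI restrict_PiE_iff[THEN iffD2]) simp
  ultimately show ?thesis
    by (rule inj_on_finite[rotated -1])
qed

lemma ser_mult_one:
  assumes "\<And>\<alpha>. infinite {i. \<alpha> i \<noteq> 0} \<Longrightarrow> f \<alpha> = 0"
  shows "ser_mult f ser_one = f"
proof
  fix \<alpha> :: "nat \<Rightarrow> nat"
  have "(\<lambda>i. \<alpha> i - \<beta> i) = (\<lambda>_. 0) \<longleftrightarrow> \<beta> = \<alpha>" if "\<forall>i. \<beta> i \<le> \<alpha> i" for \<beta>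
    using that by (auto simp: fun_eq_iff intro: le_antisym)
  then have "ser_mult f ser_one \<alpha> = (\<Sum>\<beta> | \<forall>i. \<beta> i \<le> \<alpha> i. if \<beta> = \<alpha> then f \<alpha> else 0)"
    unfolding ser_mult_def by (intro sum.cong) (auto simp: ser_one_def)
  also have "\<dots> = f \<alpha>"
  proof (cases "finite {i. \<alpha> i \<noteq> 0}")
    case True
    then show ?thesis by (simp add: finite_pointwise_le)
  next
    case False
    then have "f \<alpha> = 0" by (rule assms)
    then show ?thesis by (simp only: if_cancel sum.neutral_const)
  qed
  finally show "ser_mult f ser_one \<alpha> = f \<alpha>" .
qed

lemma ser_mult_elem_one: "ser_mult (elem k) ser_one = elem k"
  by (rule ser_mult_one) (rule elem_infinite_support)

lemma elem_part_single: "elem_part [k] = elem k"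
  by (simp add: elem_part_def ser_mult_elem_one)

lemma elem_part_pair: "elem_part [k, l] = ser_mult (elem k) (elem l)"
  by (simp add: elem_part_def ser_mult_elem_one)

lemma ser_mult_commute: "ser_mult f g \<alpha> = ser_mult g f \<alpha>"
  unfolding ser_mult_def
  by (rule sum.reindex_bij_witness[where i = "\<lambda>\<beta> i. \<alpha> i - \<beta> i" and j = "\<lambda>\<beta> i. \<alpha> i - \<beta> i"])
    (simp_all add: mult.commute)

lemma elem_part_pair_commute: "elem_part [k, l] = elem_part [l, k]"
  by (simp add: elem_part_pair fun_eq_iff ser_mult_commute[of "elem k"])

lemma elem_part_pair_0: "elem_part [k, 0] = elem_part [k]"
  by (simp add: elem_part_pair elem_part_single elem_0 ser_mult_elem_one)

lemma elem_part_pair_fun_upd_1: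
  assumes "\<alpha> c = 0"
  shows "elem_part [k, l] (\<alpha>(c := 1)) =
    (if k = 0 then 0 else elem_part [k - 1, l] \<alpha>) + (if l = 0 then 0 else elem_part [k, l - 1] \<alpha>)"
proof -
  have zero: "\<beta> c = 0" if "\<forall>i. \<beta> i \<le> \<alpha> i" for \<beta>
    using that assms by (metis le_zero_eq)
  have "elem_part [k, l] (\<alpha>(c := 1)) = ser_mult (\<lambda>\<beta>. elem k (\<beta>(c := 1))) (\<lambda>\<beta>. elem l (\<beta>(c := 0))) \<alpha>
      + (ser_mult (\<lambda>\<beta>. elem k (\<beta>(c := 0))) (\<lambda>\<beta>. elem l (\<beta>(c := 1))) \<alpha> :: 'a)"
    by (simp add: elem_part_pair ser_mult_fun_upd[of \<alpha> c, OF assms] add.commute)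
  also have "\<dots> = ser_mult (\<lambda>\<beta>. if k = 0 then 0 else elem (k - 1) \<beta>) (elem l) \<alpha>
      + ser_mult (elem k) (\<lambda>\<beta>. if l = 0 then 0 else elem (l - 1) \<beta>) \<alpha>"
    by (intro arg_cong2[where f = "(+)"] ser_mult_cong)
      (simp_all add: elem_fun_upd_1 zero fun_upd_idem del: One_nat_def)
  also have "\<dots> = (if k = 0 then 0 else elem_part [k - 1, l] \<alpha>) + (if l = 0 then 0 else elem_part [k, l - 1] \<alpha>)"
    by (simp add: elem_part_pair)
  finally show ?thesis .
qed

lemma elem_part_pair_fun_upd_2:
  assumes "\<alpha> c = 0"
  shows "elem_part [k, l] (\<alpha>(c := 2)) = (if k = 0 \<or> l = 0 then 0 else elem_part [k - 1, l - 1] \<alpha>)"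
proof -
  have zero: "\<beta> c = 0" if "\<forall>i. \<beta> i \<le> \<alpha> i" for \<beta>
    using that assms by (metis le_zero_eq)
  have "elem_part [k, l] (\<alpha>(c := 2)) = (ser_mult (\<lambda>\<beta>. elem k (\<beta>(c := 1))) (\<lambda>\<beta>. elem l (\<beta>(c := 1))) \<alpha> :: 'a)"
    by (simp add: elem_part_pair ser_mult_fun_upd[of \<alpha> c, OF assms] elem_fun_upd_ge_2 numeral_2_eq_2)
  also have "\<dots> = ser_mult (\<lambda>\<beta>. if k = 0 then 0 else elem (k - 1) \<beta>)
      (\<lambda>\<beta>. if l = 0 then 0 else elem (l - 1) \<beta> :: 'a) \<alpha>"
    by (rule ser_mult_cong) (simp_all add: elem_fun_upd_1 zero del: One_nat_def)
  finally show ?thesis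
    by (simp add: elem_part_pair)
qed

lemma elem_part_pair_fun_upd_ge_3:
  assumes "\<alpha> c = 0" "3 \<le> m"
  shows "elem_part [k, l] (\<alpha>(c := m)) = 0"
proof -
  have "ser_mult (\<lambda>\<beta>. elem k (\<beta>(c := i))) (\<lambda>\<beta>. elem l (\<beta>(c := m - i))) \<alpha> = (0 :: 'a)" for i
  proof (cases "2 \<le> i")
    case False
    with assms(2) have "2 \<le> m - i" by linarith
    then show ?thesis by (simp add: elem_fun_upd_ge_2)
  qed (simp add: elem_fun_upd_ge_2)
  then show ?thesis
    by (simp add: elem_part_pair ser_mult_fun_upd[of \<alpha> c, OF assms(1)])
qed

lemma elem_part_pair_empty_support: "elem_part [k, l] (\<lambda>_. 0) = (if k = 0 \<and> l = 0 then 1 else 0)"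
proof -
  have "{\<beta>. \<forall>i. \<beta> i \<le> (0 :: nat)} = {\<lambda>_ :: nat. 0}"
    by auto
  then show ?thesis
    by (simp add: elem_part_pair ser_mult_def elem_def)
qed

lemma elem_part_pair_infinite_support:
  assumes "infinite {i. \<alpha> i \<noteq> 0}"
  shows "elem_part [k, l] \<alpha> = 0"
proof -
  have "elem k \<beta> * elem l (\<lambda>i. \<alpha> i - \<beta> i) = (0 :: 'a)" for \<beta>
  proof (cases "finite {i. \<beta> i \<noteq> 0}")
    case True
    have "{i. \<alpha> i \<noteq> 0} \<subseteq> {i. \<beta> i \<noteq> 0} \<union> {i. \<alpha> i - \<beta> i \<noteq> 0}"
      by auto
    with True assms have "infinite {i. \<alpha> i - \<beta> i \<noteq> 0}"
      by (meson finite_UnI finite_subset)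
    then have "elem l (\<lambda>i. \<alpha> i - \<beta> i) = (0 :: 'a)"
      by (rule elem_infinite_support)
    then show ?thesis by simp
  qed (simp add: elem_infinite_support)
  then show ?thesis
    by (simp add: elem_part_pair ser_mult_def)
qed

lemma elem_of_nat: "elem k \<alpha> = of_nat (elem k \<alpha>)"
  by (simp add: elem_def)

lemma elem_part_of_nat: "elem_part lam \<alpha> = of_nat (elem_part lam \<alpha>)"
proof (induction lam arbitrary: \<alpha>)
  case (Cons k lam)
  have "elem_part (k # lam) \<alpha> = (\<Sum>\<beta> | \<forall>i. \<beta> i \<le> \<alpha> i. elem k \<beta> * elem_part lam (\<lambda>i. \<alpha> i - \<beta> i) :: 'a)"
    by (simp add: elem_part_def ser_mult_def)
  also have "\<dots> = (\<Sum>\<beta> | \<forall>i. \<beta> i \<le> \<alpha> i. of_nat (elem k \<beta> * elem_part lam (\<lambda>i. \<alpha> i - \<beta> i)))"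
    by (simp only: of_nat_mult flip: elem_of_nat Cons.IH)
  also have "\<dots> = of_nat (elem_part (k # lam) \<alpha>)"
    by (simp add: elem_part_def ser_mult_def)
  finally show ?case .
qed (simp add: elem_part_def ser_one_def)

subsection \<open>Palindromic unimodal polynomials\<close>

text \<open>
  The cone spanned by the polynomials \<open>t\<^sup>i [d + 1 - 2i]\<^sub>t\<close>, all with center of symmetry \<open>d / 2\<close>; generators
  make closure under multiplication by \<open>[k]\<^sub>t\<close> a matter of the product \<open>[k]\<^sub>t [m]\<^sub>t\<close> alone.
\<close>

inductive palindromic_unimodal :: "nat \<Rightarrow> rat poly \<Rightarrow> bool" where
  zero: "palindromic_unimodal d 0"
| qint: "palindromic_unimodal d (qint (Suc d))"
| add: "palindromic_unimodal d p \<Longrightarrow> palindromic_unimodal d q \<Longrightarrow> palindromic_unimodal d (p + q)"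
| smult: "0 \<le> c \<Longrightarrow> palindromic_unimodal d p \<Longrightarrow> palindromic_unimodal d (smult c p)"
| t_mult: "palindromic_unimodal d p \<Longrightarrow> palindromic_unimodal (d + 2) (t * p)"

lemma palindromic_unimodal_nonneg: "palindromic_unimodal d p \<Longrightarrow> 0 \<le> coeff p i"
  by (induction arbitrary: i rule: palindromic_unimodal.induct) (simp_all add: coeff_qint coeff_t_mult)

lemma palindromic_unimodal_coeff_eq_0: "palindromic_unimodal d p \<Longrightarrow> d < i \<Longrightarrow> coeff p i = 0"
  by (induction arbitrary: i rule: palindromic_unimodal.induct) (simp_all add: coeff_qint coeff_t_mult)

lemma palindromic_unimodal_sym: "palindromic_unimodal d p \<Longrightarrow> i \<le> d \<Longrightarrow> coeff p (d - i) = coeff p i"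
proof (induction arbitrary: i rule: palindromic_unimodal.induct)
  case (t_mult d p)
  have top: "coeff p (Suc d) = 0"
    by (rule palindromic_unimodal_coeff_eq_0[OF t_mult.hyps]) simp
  consider "i = 0" | "i = d + 2" | j where "i = Suc j" "j \<le> d"
    using t_mult.prems by (cases i) (auto simp: le_Suc_eq)
  then show ?case
  proof cases
    case 3
    then have "coeff (t * p) (d + 2 - i) = coeff p (d - j)"
      by (simp add: coeff_t_mult)
    with 3 t_mult.IH[of j] show ?thesis
      by (simp add: coeff_t_mult)
  qed (simp_all add: coeff_t_mult top)
qed (simp_all add: coeff_qint)

lemma palindromic_unimodal_mono: "palindromic_unimodal d p \<Longrightarrow> 2 * i < d \<Longrightarrow> coeff p i \<le> coeff p (Suc i)"
proof (induction arbitrary: i rule: palindromic_unimodal.induct)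
  case (t_mult d p)
  then show ?case
    using palindromic_unimodal_nonneg[OF t_mult.hyps] by (cases i) (simp_all add: coeff_t_mult)
qed (simp_all add: coeff_qint add_mono mult_left_mono)

lemma palindromic_unimodal_qint_mult_qint: "palindromic_unimodal (k + m) (qint (Suc k) * qint (Suc m))"
proof (induction k arbitrary: m)
  case 0
  show ?case by (simp add: palindromic_unimodal.qint)
next
  case (Suc k)
  show ?case
  proof (cases m)
    case 0
    then show ?thesis using palindromic_unimodal.qint[of "Suc k"] by simp
  next
    case (Suc l)
    have "palindromic_unimodal (k + l + 2) (t * (qint (Suc k) * qint (Suc l)))"
      by (intro palindromic_unimodal.t_mult Suc.IH)
    with palindromic_unimodal.qint show ?thesis
      unfolding qint_mult_qint[of "Suc k"] Suc by (simp add: palindromic_unimodal.add)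
  qed
qed

lemma palindromic_unimodal_qint_mult:
  assumes "palindromic_unimodal d p"
  shows "palindromic_unimodal (d + k) (qint (Suc k) * p)"
  using assms
proof induction
  case (zero d)
  show ?case by (simp add: palindromic_unimodal.zero)
next
  case (qint d)
  show ?case using palindromic_unimodal_qint_mult_qint[of k d] by (simp add: add.commute)
next
  case (add d p q)
  then show ?case by (simp add: distrib_left palindromic_unimodal.add)
next
  case (smult c d p)
  then show ?case by (simp add: palindromic_unimodal.smult)
next
  case (t_mult d p)
  from palindromic_unimodal.t_mult[OF t_mult.IH] show ?case
    by (simp add: mult.left_commute add.commute add.left_commute)
qed

lemma palindromic_unimodal_qfact_mult:
  assumes "palindromic_unimodal d p"
  shows "palindromic_unimodal ((k choose 2) + d) (qfact k * p)"
proof (induction k)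
  case 0
  then show ?case using assms by (simp add: numeral_2_eq_2)
next
  case (Suc k)
  have "Suc k choose 2 = k + (k choose 2)" by (simp add: numeral_2_eq_2)
  then show ?case
    using palindromic_unimodal_qint_mult[OF Suc.IH, of k] by (simp add: mult.assoc ac_simps)
qed

lemma palindromic_unimodal_power_t_mult:
  assumes "palindromic_unimodal d p"
  shows "palindromic_unimodal (d + 2 * k) (t ^ k * p)"
proof (induction k)
  case (Suc k)
  from palindromic_unimodal.t_mult[OF Suc.IH] show ?case
    by (simp add: mult.assoc)
qed (use assms in simp)

lemma e_positive_unimodal_sum:
  assumes L: "finite L" "\<And>lam. lam \<in> L \<Longrightarrow> is_partition lam"
    and p: "\<And>lam. lam \<in> L \<Longrightarrow> palindromic_unimodal d (p lam)"
    and X: "X = (\<lambda>\<alpha>. \<Sum>lam\<in>L. p lam * elem_part lam \<alpha>)"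
    and d: "of_nat d = 2 * c"
  shows "e_positive X" "e_unimodal X c"
proof -
  have "tcoeff X i \<alpha> = (\<Sum>lam\<in>L. coeff (p lam) i * elem_part lam \<alpha>)" for i \<alpha>
    unfolding tcoeff_def X coeff_sum
  proof (intro sum.cong refl)
    fix lam
    have "coeff (p lam * of_nat (elem_part lam \<alpha>)) i = coeff (p lam) i * of_nat (elem_part lam \<alpha>)"
      by (simp add: of_nat_poly)
    then show "coeff (p lam * elem_part lam \<alpha>) i = coeff (p lam) i * elem_part lam \<alpha>"
      by (simp only: flip: elem_part_of_nat)
  qed
  then have coeff_X: "tcoeff X i = (\<lambda>\<alpha>. \<Sum>lam\<in>L. coeff (p lam) i * elem_part lam \<alpha>)" for i
    by auto
  have e_pos: "e_pos (\<lambda>\<alpha>. \<Sum>lam\<in>L. c lam * elem_part lam \<alpha>)" if "\<And>lam. lam \<in> L \<Longrightarrow> 0 \<le> c lam" for c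
    unfolding e_pos_def using L that by blast
  show "e_positive X"
    unfolding e_positive_def coeff_X by (intro allI e_pos palindromic_unimodal_nonneg[OF p])
  have "tcoeff X i = (if i \<le> d then tcoeff X (d - i) else (\<lambda>_. 0))" for i
    using palindromic_unimodal_sym[OF p] palindromic_unimodal_coeff_eq_0[OF p] by (simp add: coeff_X)
  moreover have "e_pos (\<lambda>\<alpha>. tcoeff X (Suc i) \<alpha> - tcoeff X i \<alpha>)" if "of_nat i < c" for i
  proof -
    have "(of_nat (2 * i) :: rat) < of_nat d"
      using that d by simp
    then have "2 * i < d"
      by (simp only: of_nat_less_iff)
    then have "e_pos (\<lambda>\<alpha>. \<Sum>lam\<in>L. (coeff (p lam) (Suc i) - coeff (p lam) i) * elem_part lam \<alpha>)"
      by (intro e_pos) (simp add: palindromic_unimodal_mono[OF p])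
    then show ?thesis
      by (simp add: coeff_X left_diff_distrib sum_subtractf)
  qed
  ultimately show "e_unimodal X c"
    unfolding e_unimodal_def using d by blast
qed

subsection \<open>Removing the largest colour\<close>

definition colorings :: "nat set \<Rightarrow> (nat \<Rightarrow> nat \<Rightarrow> bool) \<Rightarrow> (nat \<Rightarrow> nat) \<Rightarrow> (nat \<Rightarrow> nat) set" where
  "colorings V E \<alpha> = {\<kappa>. \<kappa> \<in> V \<rightarrow>\<^sub>E UNIV \<and> proper_col V E \<kappa> \<and> (\<forall>c. card {v \<in> V. \<kappa> v = c} = \<alpha> c)}"

definition indep_sets :: "nat set \<Rightarrow> (nat \<Rightarrow> nat \<Rightarrow> bool) \<Rightarrow> nat \<Rightarrow> nat set set" where
  "indep_sets V E k = {C. C \<subseteq> V \<and> card C = k \<and> (\<forall>i\<in>C. \<forall>j\<in>C. \<not> E i j)}"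

definition down_degree :: "nat set \<Rightarrow> (nat \<Rightarrow> nat \<Rightarrow> bool) \<Rightarrow> nat \<Rightarrow> nat" where
  "down_degree V E v = card {i \<in> V. i < v \<and> E i v}"

lemma chrom_qsf_eq_sum_colorings: "chrom_qsf V E \<alpha> = (\<Sum>\<kappa>\<in>colorings V E \<alpha>. t ^ asc V E \<kappa>)"
  by (simp add: chrom_qsf_def colorings_def t_def)

lemma coloring_in_support:
  assumes "finite V" "\<kappa> \<in> colorings V E \<alpha>" "v \<in> V"
  shows "\<alpha> (\<kappa> v) \<noteq> 0"
proof -
  have "card {w \<in> V. \<kappa> w = \<kappa> v} = \<alpha> (\<kappa> v)"
    using assms(2) by (simp add: colorings_def)
  moreover have "v \<in> {w \<in> V. \<kappa> w = \<kappa> v}" "finite {w \<in> V. \<kappa> w = \<kappa> v}"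
    using assms by auto
  ultimately show ?thesis
    by (metis card_0_eq empty_iff)
qed

lemma support_subset_image_coloring:
  assumes "\<kappa> \<in> colorings V E \<alpha>"
  shows "{c. \<alpha> c \<noteq> 0} \<subseteq> \<kappa> ` V"
proof
  fix c assume "c \<in> {c. \<alpha> c \<noteq> 0}"
  then have "card {v \<in> V. \<kappa> v = c} \<noteq> 0"
    using assms by (simp add: colorings_def)
  then have "{v \<in> V. \<kappa> v = c} \<noteq> {}"
    by (metis card.empty)
  then show "c \<in> \<kappa> ` V"
    by blast
qed

lemma chrom_qsf_infinite_support:
  assumes "finite V" "infinite {c. \<alpha> c \<noteq> 0}"
  shows "chrom_qsf V E \<alpha> = 0"
proof -
  have "colorings V E \<alpha> = {}"
    using support_subset_image_coloring[of _ V E \<alpha>] assms by (meson equals0I finite_imageI finite_subset)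
  then show ?thesis by (simp add: chrom_qsf_eq_sum_colorings)
qed

lemma chrom_qsf_empty_support:
  assumes "finite V"
  shows "chrom_qsf V E (\<lambda>_. 0) = (if V = {} then 1 else 0)"
proof (cases "V = {}")
  case True
  then have "colorings V E (\<lambda>_. 0) = {\<lambda>_. undefined}"
    by (auto simp: colorings_def proper_col_def)
  then show ?thesis
    using True by (simp add: chrom_qsf_eq_sum_colorings asc_def)
next
  case False
  then have "colorings V E (\<lambda>_. 0) = {}"
    using coloring_in_support[OF assms, of _ E "\<lambda>_. 0"] by blast
  then show ?thesis
    using False by (simp add: chrom_qsf_eq_sum_colorings)
qed

lemma asc_eq_sum:
  assumes "finite V"
  shows "asc V E \<kappa> = (\<Sum>j\<in>V. card {i \<in> V. i < j \<and> E i j \<and> \<kappa> i < \<kappa> j})"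
proof -
  let ?S = "SIGMA j:V. {i \<in> V. i < j \<and> E i j \<and> \<kappa> i < \<kappa> j}"
  have "{(i, j). i \<in> V \<and> j \<in> V \<and> i < j \<and> E i j \<and> \<kappa> i < \<kappa> j} = prod.swap ` ?S"
    by force
  then have "asc V E \<kappa> = card ?S"
    by (simp add: asc_def card_image)
  then show ?thesis
    using assms by simp
qed

lemma asc_top_class:
  assumes "finite V" "C \<in> indep_sets V E k"
    and "\<And>i. i \<in> C \<Longrightarrow> \<kappa> i = c" "\<And>i. i \<in> V - C \<Longrightarrow> \<kappa> i < c"
  shows "asc V E \<kappa> = (\<Sum>v\<in>C. down_degree V E v) + asc (V - C) E (restrict \<kappa> (V - C))"
proof -
  have C: "C \<subseteq> V" "\<And>i j. i \<in> C \<Longrightarrow> j \<in> C \<Longrightarrow> \<not> E i j"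
    using assms(2) by (auto simp: indep_sets_def)
  have "{i \<in> V. i < j \<and> E i j \<and> \<kappa> i < \<kappa> j} = {i \<in> V. i < j \<and> E i j}" if "j \<in> C" for j
    using that C(2) assms(3,4) by auto
  moreover have "{i \<in> V. i < j \<and> E i j \<and> \<kappa> i < \<kappa> j}
      = {i \<in> V - C. i < j \<and> E i j \<and> restrict \<kappa> (V - C) i < restrict \<kappa> (V - C) j}" if "j \<in> V - C" for j
  proof -
    have "i \<notin> C" if "\<kappa> i < \<kappa> j" for i
      using assms(3)[of i] assms(4)[OF \<open>j \<in> V - C\<close>] that by auto
    then show ?thesis using that by auto
  qed
  ultimately show ?thesis
    using assms(1) C(1)
    by (simp add: asc_eq_sum sum.subset_diff[of C V] down_degree_def add.commute)
qed

lemma restrict_coloring: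
  assumes "\<kappa> \<in> colorings V E \<alpha>" "{v \<in> V. \<kappa> v = c} = C"
  shows "restrict \<kappa> (V - C) \<in> colorings (V - C) E (\<alpha>(c := 0))"
proof -
  have "card {v \<in> V - C. restrict \<kappa> (V - C) v = d} = (\<alpha>(c := 0)) d" for d
  proof -
    have "{v \<in> V - C. restrict \<kappa> (V - C) v = d} = (if d = c then {} else {v \<in> V. \<kappa> v = d})"
      using assms(2) by auto
    then show ?thesis
      using assms(1) by (simp add: colorings_def)
  qed
  with assms(1) show ?thesis
    by (simp add: colorings_def proper_col_def)
qed

lemma extend_coloring:
  assumes "finite V" "C \<in> indep_sets V E (\<alpha> c)" "\<kappa> \<in> colorings (V - C) E (\<alpha>(c := 0))"
  defines "\<kappa>' \<equiv> \<lambda>v. if v \<in> C then c else \<kappa> v"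
  shows "\<kappa>' \<in> colorings V E \<alpha>" "{v \<in> V. \<kappa>' v = c} = C"
proof -
  have C: "C \<subseteq> V" "card C = \<alpha> c" "\<And>i j. i \<in> C \<Longrightarrow> j \<in> C \<Longrightarrow> \<not> E i j"
    using assms(2) by (auto simp: indep_sets_def)
  have not_top: "\<kappa> v \<noteq> c" if "v \<in> V - C" for v
    using coloring_in_support[OF finite_Diff[OF assms(1)] assms(3) that] by auto
  then show top_class: "{v \<in> V. \<kappa>' v = c} = C"
    using C(1) by (auto simp: \<kappa>'_def)
  have "proper_col V E \<kappa>'"
    using C not_top assms(3) by (auto simp: \<kappa>'_def colorings_def proper_col_def)
  moreover have "card {v \<in> V. \<kappa>' v = d} = \<alpha> d" for d
  proof (cases "d = c")
    case False
    then have "{v \<in> V. \<kappa>' v = d} = {v \<in> V - C. \<kappa> v = d}"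
      by (auto simp: \<kappa>'_def)
    then show ?thesis
      using assms(3) False by (simp add: colorings_def)
  qed (use top_class C(2) in simp)
  ultimately show "\<kappa>' \<in> colorings V E \<alpha>"
    using C(1) assms(3) by (auto simp: \<kappa>'_def colorings_def PiE_iff extensional_def)
qed

lemma bij_betw_restrict_colorings:
  assumes "finite V" "C \<in> indep_sets V E (\<alpha> c)"
  shows "bij_betw (\<lambda>\<kappa>. restrict \<kappa> (V - C)) {\<kappa> \<in> colorings V E \<alpha>. {v \<in> V. \<kappa> v = c} = C}
    (colorings (V - C) E (\<alpha>(c := 0)))"
    (is "bij_betw _ ?A ?B")
proof (rule bij_betw_byWitness[where f' = "\<lambda>\<kappa> v. if v \<in> C then c else \<kappa> v"])
  show "\<forall>\<kappa>\<in>?A. (\<lambda>v. if v \<in> C then c else restrict \<kappa> (V - C) v) = \<kappa>"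
    using assms(2) by (auto simp: indep_sets_def colorings_def PiE_iff extensional_def fun_eq_iff)
  show "\<forall>\<kappa>\<in>?B. restrict (\<lambda>v. if v \<in> C then c else \<kappa> v) (V - C) = \<kappa>"
    by (auto simp: colorings_def PiE_iff extensional_def fun_eq_iff)
  show "(\<lambda>\<kappa>. restrict \<kappa> (V - C)) ` ?A \<subseteq> ?B"
    by (intro image_subsetI) (simp add: restrict_coloring)
  show "(\<lambda>\<kappa> v. if v \<in> C then c else \<kappa> v) ` ?B \<subseteq> ?A"
    by (intro image_subsetI CollectI conjI extend_coloring[of V C E \<alpha> c, OF assms])
qed

lemma chrom_qsf_top_color:
  assumes "finite V" "\<forall>c'>c. \<alpha> c' = 0"
  shows "chrom_qsf V E \<alpha> = (\<Sum>C\<in>indep_sets V E (\<alpha> c).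
           t ^ (\<Sum>v\<in>C. down_degree V E v) * chrom_qsf (V - C) E (\<alpha>(c := 0)))"
proof -
  have bound: "\<kappa> v \<le> c" if "\<kappa> \<in> colorings V E \<alpha>" "v \<in> V" for \<kappa> v
    using coloring_in_support[OF assms(1) that] assms(2) by (meson linorder_not_less)
  have "colorings V E \<alpha> \<subseteq> V \<rightarrow>\<^sub>E {..c}"
    using bound by (auto simp: colorings_def PiE_iff extensional_def)
  then have finite_col: "finite (colorings V E \<alpha>)"
    using assms(1) by (meson finite_PiE finite_atMost finite_subset)
  have finite_indep: "finite (indep_sets V E (\<alpha> c))"
    using assms(1) by (auto simp: indep_sets_def intro: finite_subset[of _ "Pow V"])
  have top_class: "{v \<in> V. \<kappa> v = c} \<in> indep_sets V E (\<alpha> c)" if "\<kappa> \<in> colorings V E \<alpha>" for \<kappa>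
    using that by (simp add: colorings_def indep_sets_def proper_col_def) metis
  have "(\<Sum>\<kappa> | \<kappa> \<in> colorings V E \<alpha> \<and> {v \<in> V. \<kappa> v = c} = C. t ^ asc V E \<kappa>)
      = t ^ (\<Sum>v\<in>C. down_degree V E v) * chrom_qsf (V - C) E (\<alpha>(c := 0))"
    if C: "C \<in> indep_sets V E (\<alpha> c)" for C
  proof -
    have "asc V E \<kappa> = (\<Sum>v\<in>C. down_degree V E v) + asc (V - C) E (restrict \<kappa> (V - C))"
      if "\<kappa> \<in> colorings V E \<alpha>" "{v \<in> V. \<kappa> v = c} = C" for \<kappa>
      using bound[OF that(1)] that(2)
      by (intro asc_top_class[OF assms(1) C, of _ c]) (force simp: order.strict_iff_order)+
    then have "(\<Sum>\<kappa> | \<kappa> \<in> colorings V E \<alpha> \<and> {v \<in> V. \<kappa> v = c} = C. t ^ asc V E \<kappa>)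
      = (\<Sum>\<kappa> | \<kappa> \<in> colorings V E \<alpha> \<and> {v \<in> V. \<kappa> v = c} = C.
          t ^ (\<Sum>v\<in>C. down_degree V E v) * t ^ asc (V - C) E (restrict \<kappa> (V - C)))"
      by (intro sum.cong) (auto simp: power_add)
    then show ?thesis
      using sum.reindex_bij_betw[OF bij_betw_restrict_colorings[of V C E \<alpha> c, OF assms(1) C],
          of "\<lambda>\<kappa>. t ^ asc (V - C) E \<kappa>"]
      by (simp add: chrom_qsf_eq_sum_colorings flip: sum_distrib_left)
  qed
  with sum.group[OF finite_col finite_indep, of "\<lambda>\<kappa>. {v \<in> V. \<kappa> v = c}" "\<lambda>\<kappa>. t ^ asc V E \<kappa>"] top_class show ?thesis
    by (simp add: chrom_qsf_eq_sum_colorings image_subset_iff)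
qed

subsection \<open>Blow-ups of interval graphs by cliques\<close>

text \<open>
  For a graph made of consecutive cliques of sizes \<open>x 0, \<dots>, x (b - 1)\<close>, whose vertices are adjacent iff the
  indices of their cliques differ by at most \<open>w\<close>: how a function of the sizes accumulates when the class of
  the largest colour, a vertex or a non-edge, is removed.
\<close>

definition below :: "nat \<Rightarrow> (nat \<Rightarrow> nat) \<Rightarrow> nat \<Rightarrow> nat" where
  "below w x p = sum x {p - w..<p}"

definition single_removal ::
  "nat \<Rightarrow> nat \<Rightarrow> ((nat \<Rightarrow> nat) \<Rightarrow> rat poly) \<Rightarrow> (nat \<Rightarrow> nat) \<Rightarrow> rat poly" where
  "single_removal w b F x = (\<Sum>p<b. t ^ below w x p * qint (x p) * F (x(p := x p - 1)))"

definition pair_removal ::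
  "nat \<Rightarrow> nat \<Rightarrow> ((nat \<Rightarrow> nat) \<Rightarrow> rat poly) \<Rightarrow> (nat \<Rightarrow> nat) \<Rightarrow> rat poly" where
  "pair_removal w b F x = (\<Sum>(p, q) | p + w < q \<and> q < b.
     (t ^ below w x p * qint (x p)) * (t ^ below w x q * qint (x q)) * F (x(p := x p - 1, q := x q - 1)))"

locale block_graph =
  fixes S :: "nat set" and E :: "nat \<Rightarrow> nat \<Rightarrow> bool" and blk :: "nat \<Rightarrow> nat" and w b :: nat
  assumes finite_vertices: "finite S"
    and blk_mono: "\<lbrakk>u \<in> S; v \<in> S; u < v\<rbrakk> \<Longrightarrow> blk u \<le> blk v"
    and blk_less: "v \<in> S \<Longrightarrow> blk v < b"
    and edge_iff: "\<lbrakk>u \<in> S; v \<in> S\<rbrakk> \<Longrightarrow> E u v \<longleftrightarrow> u \<noteq> v \<and> blk u \<le> blk v + w \<and> blk v \<le> blk u + w"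
begin

definition block :: "nat set \<Rightarrow> nat \<Rightarrow> nat set" where
  "block V p = {v \<in> V. blk v = p}"

definition block_sizes :: "nat set \<Rightarrow> nat \<Rightarrow> nat" where
  "block_sizes V p = card (block V p)"

lemma finite_subset_vertices: "V \<subseteq> S \<Longrightarrow> finite V"
  using finite_vertices by (rule rev_finite_subset)

lemma finite_block [simp]: "V \<subseteq> S \<Longrightarrow> finite (block V p)"
  using finite_subset_vertices by (simp add: block_def)

lemma block_sizes_remove:
  assumes "v \<in> V"
  shows "block_sizes (V - {v}) = (block_sizes V)(blk v := block_sizes V (blk v) - 1)"
proof
  fix p
  have "block (V - {v}) p = block V p - {v}" "v \<in> block V p \<longleftrightarrow> blk v = p"
    using assms by (auto simp: block_def)
  then show "block_sizes (V - {v}) p = ((block_sizes V)(blk v := block_sizes V (blk v) - 1)) p"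
    by (simp add: block_sizes_def card_Diff_singleton_if)
qed

lemma block_sizes_mono: "V \<subseteq> W \<Longrightarrow> W \<subseteq> S \<Longrightarrow> block_sizes V p \<le> block_sizes W p"
  unfolding block_sizes_def by (intro card_mono finite_block) (auto simp: block_def)

lemma sum_blocks:
  assumes "V \<subseteq> S"
  shows "(\<Sum>p<b. \<Sum>v\<in>block V p. f v) = sum f V"
  unfolding block_def
  by (rule sum.group) (use finite_subset_vertices[OF assms] assms blk_less in auto)

lemma sum_block_sizes: "V \<subseteq> S \<Longrightarrow> sum (block_sizes V) {..<b} = card V"
  using sum_blocks[of V "\<lambda>_. 1 :: nat"] by (simp add: block_sizes_def)

lemma down_degree_block:
  assumes "V \<subseteq> S" "v \<in> block V p"
  shows "down_degree V E v = below w (block_sizes V) p + card {i \<in> block V p. i < v}"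
proof -
  have v: "v \<in> V" "v \<in> S" "blk v = p"
    using assms by (auto simp: block_def)
  have "{i \<in> V. i < v \<and> E i v} = (\<Union>q\<in>{p - w..<p}. block V q) \<union> {i \<in> block V p. i < v}"
  proof (rule set_eqI)
    fix i
    show "i \<in> {i \<in> V. i < v \<and> E i v} \<longleftrightarrow> i \<in> (\<Union>q\<in>{p - w..<p}. block V q) \<union> {i \<in> block V p. i < v}"
      using edge_iff[of i v] blk_mono[of i v] blk_mono[of v i] assms(1) v
      by (cases i v rule: linorder_cases) (auto simp: block_def)
  qed
  moreover have "card (\<Union>q\<in>{p - w..<p}. block V q) = below w (block_sizes V) p"
    unfolding below_def block_sizes_def
    by (rule card_UN_disjoint) (simp_all add: assms(1), auto simp: block_def)
  moreover have "(\<Union>q\<in>{p - w..<p}. block V q) \<inter> {i \<in> block V p. i < v} = {}"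
    by (auto simp: block_def)
  ultimately show ?thesis
    using assms(1) by (simp add: down_degree_def card_Un_disjoint)
qed

lemma sum_power_t_down_degree:
  assumes "V \<subseteq> S"
  shows "(\<Sum>v\<in>block V p. t ^ down_degree V E v) = t ^ below w (block_sizes V) p * qint (block_sizes V p)"
proof -
  have "(\<Sum>v\<in>block V p. t ^ down_degree V E v)
      = (\<Sum>v\<in>block V p. t ^ below w (block_sizes V) p * t ^ card {i \<in> block V p. i < v})"
    using down_degree_block[OF assms] by (simp add: power_add)
  then show ?thesis
    using sum_power_t_rank[OF finite_block[OF assms]] by (simp add: block_sizes_def flip: sum_distrib_left)
qed

lemma chrom_qsf_top_single:
  assumes V: "V \<subseteq> S" and \<beta>: "\<forall>c'\<ge>c. \<beta> c' = 0"
    and remove: "\<And>v. v \<in> V \<Longrightarrow> chrom_qsf (V - {v}) E \<beta> = F (block_sizes (V - {v}))"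
  shows "chrom_qsf V E (\<beta>(c := 1)) = single_removal w b F (block_sizes V)"
proof -
  let ?x = "block_sizes V"
  have "indep_sets V E 1 = (\<lambda>v. {v}) ` V"
    using edge_iff V by (force simp: indep_sets_def card_1_singleton_iff)
  then have "chrom_qsf V E (\<beta>(c := 1)) = (\<Sum>v\<in>V. t ^ down_degree V E v * chrom_qsf (V - {v}) E \<beta>)"
    using chrom_qsf_top_color[OF finite_subset_vertices[OF V], of c "\<beta>(c := 1)" E] \<beta>
    by (simp add: fun_upd_idem sum.reindex)
  also have "\<dots> = (\<Sum>v\<in>V. t ^ down_degree V E v * F (?x(blk v := ?x (blk v) - 1)))"
    by (simp add: remove block_sizes_remove)
  also have "\<dots> = (\<Sum>p<b. \<Sum>v\<in>block V p. t ^ down_degree V E v * F (?x(p := ?x p - 1)))"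
    unfolding sum_blocks[OF V, symmetric] by (intro sum.cong) (auto simp: block_def)
  also have "\<dots> = single_removal w b F ?x"
    by (simp add: single_removal_def sum_power_t_down_degree[OF V] flip: sum_distrib_right)
  finally show ?thesis .
qed

lemma indep_sets_2:
  assumes "V \<subseteq> S"
  shows "indep_sets V E 2 = (\<lambda>(u, v). {u, v}) ` {(u, v) \<in> V \<times> V. blk u + w < blk v}"
proof (intro equalityI subsetI)
  fix C assume "C \<in> indep_sets V E 2"
  then obtain u v where C: "C = {u, v}" "u \<in> V" "v \<in> V" "u \<noteq> v" "\<not> E u v"
    by (auto simp: indep_sets_def card_2_iff)
  then have "blk u + w < blk v \<or> blk v + w < blk u"
    using edge_iff[of u v] subsetD[OF assms] by auto
  then show "C \<in> (\<lambda>(u, v). {u, v}) ` {(u, v) \<in> V \<times> V. blk u + w < blk v}"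
    using C by (auto simp: image_iff)
next
  fix C assume "C \<in> (\<lambda>(u, v). {u, v}) ` {(u, v) \<in> V \<times> V. blk u + w < blk v}"
  then obtain u v where C: "C = {u, v}" "u \<in> V" "v \<in> V" "blk u + w < blk v"
    by auto
  then have "u \<noteq> v"
    by auto
  then show "C \<in> indep_sets V E 2"
    using C edge_iff subsetD[OF assms] by (auto simp: indep_sets_def)
qed

lemma sum_nonadjacent_pairs:
  assumes "V \<subseteq> S"
  shows "(\<Sum>(u, v) | u \<in> V \<and> v \<in> V \<and> blk u + w < blk v. f u v)
    = (\<Sum>(p, q) | p + w < q \<and> q < b. \<Sum>u\<in>block V p. \<Sum>v\<in>block V q. f u v)"
    (is "sum _ ?P = sum _ ?Q")
proof -
  let ?blks = "\<lambda>(u, v). (blk u, blk v)"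
  have "finite ?P" "finite ?Q"
    using finite_subset_vertices[OF assms]
    by (auto intro: finite_subset[of _ "V \<times> V"] finite_subset[of _ "{..<b} \<times> {..<b}"])
  moreover have "?blks ` ?P \<subseteq> ?Q"
    using blk_less assms by auto
  ultimately have "(\<Sum>(u, v)\<in>?P. f u v) = (\<Sum>pq\<in>?Q. \<Sum>(u, v) | (u, v) \<in> ?P \<and> ?blks (u, v) = pq. f u v)"
    using sum.group[of ?P ?Q ?blks "\<lambda>(u, v). f u v"] by (simp add: split_def)
  also have "\<dots> = (\<Sum>(p, q)\<in>?Q. \<Sum>(u, v)\<in>block V p \<times> block V q. f u v)"
    by (rule sum.cong[OF refl]) (auto simp: block_def intro!: sum.cong)
  finally show ?thesis
    by (simp add: sum.cartesian_product)
qed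

lemma chrom_qsf_top_pair:
  assumes V: "V \<subseteq> S" and \<beta>: "\<forall>c'\<ge>c. \<beta> c' = 0"
    and remove: "\<And>u v. u \<in> V \<Longrightarrow> v \<in> V \<Longrightarrow> chrom_qsf (V - {u, v}) E \<beta> = F (block_sizes (V - {u, v}))"
  shows "chrom_qsf V E (\<beta>(c := 2)) = pair_removal w b F (block_sizes V)"
proof -
  let ?x = "block_sizes V" and ?P = "{(u, v). u \<in> V \<and> v \<in> V \<and> blk u + w < blk v}"
  let ?F = "\<lambda>p q. F (?x(p := ?x p - 1, q := ?x q - 1))"
  let ?d = "down_degree V E"
  have sizes: "block_sizes (V - {u, v}) = ?x(blk u := ?x (blk u) - 1, blk v := ?x (blk v) - 1)"
    if "u \<in> V" "v \<in> V" "blk u + w < blk v" for u v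
  proof -
    have "V - {u, v} = V - {u} - {v}" "v \<in> V - {u}"
      using that by auto
    with that show ?thesis
      by (simp add: block_sizes_remove)
  qed
  have inj: "inj_on (\<lambda>(u, v). {u, v}) ?P"
    by (auto simp: inj_on_def doubleton_eq_iff)
  have "chrom_qsf V E (\<beta>(c := 2)) = (\<Sum>C\<in>indep_sets V E 2. t ^ (\<Sum>i\<in>C. ?d i) * chrom_qsf (V - C) E \<beta>)"
    using chrom_qsf_top_color[OF finite_subset_vertices[OF V], of c "\<beta>(c := 2)" E] \<beta>
    by (simp add: fun_upd_idem)
  also have "\<dots> = (\<Sum>(u, v)\<in>?P. t ^ (\<Sum>i\<in>{u, v}. ?d i) * chrom_qsf (V - {u, v}) E \<beta>)"
    unfolding indep_sets_2[OF V] by (subst sum.reindex) (use inj in \<open>simp_all add: split_def\<close>)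
  also have "\<dots> = (\<Sum>(u, v)\<in>?P. t ^ ?d u * t ^ ?d v * ?F (blk u) (blk v))"
  proof (rule sum.cong[OF refl], clarify)
    fix u v assume uv: "u \<in> V" "v \<in> V" "blk u + w < blk v"
    then have "u \<noteq> v"
      by auto
    then show "t ^ (\<Sum>i\<in>{u, v}. ?d i) * chrom_qsf (V - {u, v}) E \<beta> = t ^ ?d u * t ^ ?d v * ?F (blk u) (blk v)"
      using uv by (simp add: remove sizes power_add)
  qed
  also have "\<dots> = (\<Sum>(p, q) | p + w < q \<and> q < b. \<Sum>u\<in>block V p. \<Sum>v\<in>block V q. t ^ ?d u * t ^ ?d v * ?F p q)"
    unfolding sum_nonadjacent_pairs[OF V] by (intro sum.cong refl) (auto simp: block_def)
  also have "\<dots> = pair_removal w b F ?x"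
    by (simp add: pair_removal_def sum_power_t_down_degree[OF V] flip: sum_distrib_right sum_product)
  finally show ?thesis .
qed

lemma card_indep_set_le:
  assumes "C \<in> indep_sets S E k"
  shows "k \<le> Suc ((b - 1) div Suc w)"
proof -
  have C: "C \<subseteq> S" "card C = k" "\<And>u v. u \<in> C \<Longrightarrow> v \<in> C \<Longrightarrow> \<not> E u v"
    using assms by (auto simp: indep_sets_def)
  have "inj_on (\<lambda>v. blk v div Suc w) C"
  proof
    fix u v assume uv: "u \<in> C" "v \<in> C" "blk u div Suc w = blk v div Suc w"
    have "p \<le> q + w" if "p div Suc w = q div Suc w" for p q
    proof -
      have "p = q div Suc w * Suc w + p mod Suc w"
        by (simp only: that[symmetric] div_mult_mod_eq)
      also have "\<dots> \<le> q + w"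
        by (intro add_mono div_times_less_eq_dividend mod_Suc_le_divisor)
      finally show ?thesis .
    qed
    then have "blk u \<le> blk v + w" "blk v \<le> blk u + w"
      using uv(3) by simp_all
    then show "u = v"
      using C uv edge_iff[of u v] by auto
  qed
  moreover have "(\<lambda>v. blk v div Suc w) ` C \<subseteq> {..(b - 1) div Suc w}"
    using C(1) blk_less by (fastforce intro: div_le_mono)
  ultimately show ?thesis
    using card_inj_on_le[of "\<lambda>v. blk v div Suc w" C "{..(b - 1) div Suc w}"] C(2) by simp
qed

lemma chrom_qsf_top_large:
  assumes V: "V \<subseteq> S" and \<beta>: "\<forall>c'>c. \<beta> c' = 0" and "Suc ((b - 1) div Suc w) < \<beta> c"
  shows "chrom_qsf V E \<beta> = 0"
proof -
  have "indep_sets V E (\<beta> c) \<subseteq> indep_sets S E (\<beta> c)"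
    using V by (auto simp: indep_sets_def)
  then have "indep_sets V E (\<beta> c) = {}"
    using card_indep_set_le[of _ "\<beta> c"] assms(3) by fastforce
  then show ?thesis
    using chrom_qsf_top_color[OF finite_subset_vertices[OF V] \<beta>] by simp
qed

end

subsection \<open>Weights of non-edges and of pairs of disjoint non-edges\<close>

text \<open>
  Now \<open>w = 2\<close> and \<open>b = 5\<close>: the non-adjacent pairs of blocks are \<open>(0, 3)\<close>, \<open>(0, 4)\<close> and \<open>(1, 4)\<close>. A non-edge
  weighs \<open>t\<close> to the sum of its down-degrees; a pair of disjoint non-edges can be removed in two orders, whose
  weights differ by a factor \<open>t\<close>, whence the factor \<open>1 + t\<close> in the recursions. Truncated subtraction is
  harmless throughout, as the factor in front then vanishes.
\<close>

definition nonedge_weight :: "(nat \<Rightarrow> nat) \<Rightarrow> rat poly" where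
  "nonedge_weight x = t ^ (x 2 + x 3) * qint (x 0 + x 1) * qint (x 4) + t ^ (x 1 + x 2) * qint (x 0) * qint (x 3)"

definition nonedge_pair_weight :: "(nat \<Rightarrow> nat) \<Rightarrow> rat poly" where
  "nonedge_pair_weight x =
     t ^ (x 1 + 2 * x 2 + x 3 - 1) * qint (x 0) * qint (x 1) * qint (x 3) * qint (x 4)"

lemma sum_lessThan_5: "(\<Sum>p<5. f p) = f 0 + f 1 + f 2 + f 3 + f (4 :: nat)"
  by (simp add: eval_nat_numeral)

lemma below_2: "below 2 x 0 = 0" "below 2 x 1 = x 0" "below 2 x 2 = x 0 + x 1"
    "below 2 x 3 = x 1 + x 2" "below 2 x 4 = x 2 + x 3"
  by (simp_all add: below_def eval_nat_numeral)

lemma single_removal_2_5: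
  "single_removal 2 5 F x = qint (x 0) * F (x(0 := x 0 - 1)) + t ^ x 0 * qint (x 1) * F (x(1 := x 1 - 1))
     + t ^ (x 0 + x 1) * qint (x 2) * F (x(2 := x 2 - 1)) + t ^ (x 1 + x 2) * qint (x 3) * F (x(3 := x 3 - 1))
     + t ^ (x 2 + x 3) * qint (x 4) * F (x(4 := x 4 - 1))"
  by (simp add: single_removal_def sum_lessThan_5 below_2 del: One_nat_def)

lemma pair_removal_2_5:
  "pair_removal 2 5 F x = t ^ (x 1 + x 2) * qint (x 0) * qint (x 3) * F (x(0 := x 0 - 1, 3 := x 3 - 1))
     + t ^ (x 2 + x 3) * qint (x 0) * qint (x 4) * F (x(0 := x 0 - 1, 4 := x 4 - 1))
     + t ^ (x 0 + x 2 + x 3) * qint (x 1) * qint (x 4) * F (x(1 := x 1 - 1, 4 := x 4 - 1))"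
proof -
  have "{(p, q). p + 2 < q \<and> q < 5} = {(0, 3), (0, 4), (1, 4 :: nat)}"
    by auto
  then show ?thesis
    by (simp add: pair_removal_def below_2 power_add add.assoc mult_ac del: One_nat_def)
qed

lemma nonedge_weight_eq_0: "sum x {..<5} < 2 \<Longrightarrow> nonedge_weight x = 0"
proof -
  assume "sum x {..<5} < 2"
  then have "x 0 + x 1 = 0 \<or> x 4 = 0" "x 0 = 0 \<or> x 3 = 0"
    by (auto simp: sum_lessThan_5)
  then show "nonedge_weight x = 0"
    by (auto simp: nonedge_weight_def)
qed

lemma nonedge_pair_weight_eq_0: "sum x {..<5} < 4 \<Longrightarrow> nonedge_pair_weight x = 0"
proof -
  assume "sum x {..<5} < 4"
  then have "x 0 = 0 \<or> x 1 = 0 \<or> x 3 = 0 \<or> x 4 = 0"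
    unfolding sum_lessThan_5 by linarith
  then show "nonedge_pair_weight x = 0"
    by (auto simp: nonedge_pair_weight_def)
qed

lemma single_removal_one:
  assumes "x 0 \<le> 1" "x 4 \<le> 1"
  shows "single_removal 2 5 (\<lambda>_. 1) x = qint (sum x {..<5}) + (1 - t) * nonedge_weight x"
proof -
  obtain a b k where x: "x 1 = a" "x 2 = b" "x 3 = k" by simp
  have "x 0 = 0 \<or> x 0 = 1" "x 4 = 0 \<or> x 4 = 1"
    using assms by linarith+
  then show ?thesis
    by (elim disjE) (simp_all add: x single_removal_2_5 nonedge_weight_def sum_lessThan_5 qint_add qint_Suc
        power_add power_t_eq_qint[of a] power_t_eq_qint[of b] power_t_eq_qint[of k] algebra_simps del: One_nat_def)
qed

lemma pair_removal_one: "pair_removal 2 5 (\<lambda>_. 1) x = nonedge_weight x"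
  by (simp add: pair_removal_2_5 nonedge_weight_def qint_add power_add algebra_simps)

lemma t_mult_single_removal_nonedge_weight:
  "t * single_removal 2 5 nonedge_weight x = (single_removal 2 5 (\<lambda>_. 1) x - 1) * nonedge_weight x
     - t ^ (2 * (x 1 + x 2)) * qint (x 0) * qint (x 3) - t ^ (2 * (x 2 + x 3)) * qint (x 0 + x 1) * qint (x 4)
     + (t - 1) * t ^ (x 1 + 2 * x 2 + x 3) * qint (x 0) * qint (x 3) * qint (x 4)"
proof -
  let ?\<pi> = "nonedge_weight x"
  obtain l a b k r where x: "x 0 = l" "x 1 = a" "x 2 = b" "x 3 = k" "x 4 = r" by simp
  have "t * (qint l * nonedge_weight (x(0 := l - 1))) = qint l * (?\<pi> - t ^ (b + k) * qint r - t ^ (a + b) * qint k)"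
    by (cases l) (simp_all add: x nonedge_weight_def qint_Suc algebra_simps del: One_nat_def)
  moreover have "t * (qint a * nonedge_weight (x(1 := a - 1))) = qint a * (?\<pi> - t ^ (b + k) * qint r)"
    by (cases a) (simp_all add: x nonedge_weight_def qint_Suc algebra_simps del: One_nat_def)
  moreover have "t * (qint b * nonedge_weight (x(2 := b - 1))) = qint b * ?\<pi>"
    by (cases b) (simp_all add: x nonedge_weight_def qint_Suc algebra_simps del: One_nat_def)
  moreover have "t * (qint k * nonedge_weight (x(3 := k - 1))) = qint k * (?\<pi> - t ^ (a + b) * qint l)"
    by (cases k) (simp_all add: x nonedge_weight_def qint_Suc algebra_simps del: One_nat_def)
  moreover have "t * (qint r * nonedge_weight (x(4 := r - 1)))
      = qint r * (?\<pi> - t ^ (b + k) * qint (l + a) + (t - 1) * t ^ (a + b) * qint l * qint k)"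
    by (cases r) (simp_all add: x nonedge_weight_def qint_Suc algebra_simps del: One_nat_def)
  ultimately have "t * single_removal 2 5 nonedge_weight x
      = qint l * (?\<pi> - t ^ (b + k) * qint r - t ^ (a + b) * qint k)
        + t ^ l * (qint a * (?\<pi> - t ^ (b + k) * qint r)) + t ^ (l + a) * (qint b * ?\<pi>)
        + t ^ (a + b) * (qint k * (?\<pi> - t ^ (a + b) * qint l))
        + t ^ (b + k) * (qint r * (?\<pi> - t ^ (b + k) * qint (l + a) + (t - 1) * t ^ (a + b) * qint l * qint k))"
    by (simp only: single_removal_2_5 x distrib_left mult.assoc mult.left_commute[of t])
  also have "\<dots> = (single_removal 2 5 (\<lambda>_. 1) x - 1) * ?\<pi> - t ^ (2 * (x 1 + x 2)) * qint (x 0) * qint (x 3)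
     - t ^ (2 * (x 2 + x 3)) * qint (x 0 + x 1) * qint (x 4)
     + (t - 1) * t ^ (x 1 + 2 * x 2 + x 3) * qint (x 0) * qint (x 3) * qint (x 4)"
    unfolding single_removal_2_5 nonedge_weight_def x qint_add[of l] power_add mult_2 by algebra
  finally show ?thesis .
qed

lemma t_mult_nonedge_pair_weight:
  "t * nonedge_pair_weight x = t ^ (x 1 + 2 * x 2 + x 3) * qint (x 0) * qint (x 1) * qint (x 3) * qint (x 4)"
  by (cases "x 1") (simp_all add: nonedge_pair_weight_def mult.assoc)

lemma nonedge_weight_square:
  assumes "x 0 \<le> 1" "x 4 \<le> 1"
  shows "t ^ (sum x {..<5} - 1) * nonedge_weight x + (1 - t) * (nonedge_weight x)\<^sup>2
       - t ^ (2 * (x 1 + x 2)) * qint (x 0) * qint (x 3) - t ^ (2 * (x 2 + x 3)) * qint (x 0 + x 1) * qint (x 4)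
       + (t - 1) * t ^ (x 1 + 2 * x 2 + x 3) * qint (x 0) * qint (x 3) * qint (x 4)
     = (1 - t\<^sup>2) * (t * nonedge_pair_weight x)"
proof -
  note expand = t_mult_nonedge_pair_weight nonedge_weight_def sum_lessThan_5
    qint_add qint_0 qint_1 power_add power_0 power_one_right mult_2 add_0 add_0_right
  obtain a b k where x: "x 1 = a" "x 2 = b" "x 3 = k" by simp
  note to_qint = power_t_eq_qint[of a] power_t_eq_qint[of k]
  consider "x 0 = 0" "x 4 = 0" | "x 0 = 0" "x 4 = 1" | "x 0 = 1" "x 4 = 0" | "x 0 = 1" "x 4 = 1"
    using assms by linarith
  then show ?thesis
  proof cases
    case 1
    then show ?thesis by (simp add: expand)
  next
    case 2
    show ?thesis unfolding expand 2 x add_diff_cancel_right' to_qint by algebra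
  next
    case 3
    show ?thesis unfolding expand 3 x add.assoc add_diff_cancel_left' to_qint by algebra
  next
    case 4
    show ?thesis unfolding expand 4 x add_diff_cancel_right' to_qint by algebra
  qed
qed

lemma single_removal_nonedge_weight:
  assumes "x 0 \<le> 1" "x 4 \<le> 1"
  shows "single_removal 2 5 nonedge_weight x
    = qint (sum x {..<5} - 2) * nonedge_weight x + (1 - t\<^sup>2) * nonedge_pair_weight x"
proof -
  let ?N = "sum x {..<5}" and ?\<pi> = "nonedge_weight x" and ?\<mu> = "nonedge_pair_weight x"
  have "t * (qint (?N - 2) * ?\<pi>) = (qint ?N - t ^ (?N - 1) - 1) * ?\<pi>"
  proof (cases "?N < 2")
    case False
    then obtain M where N: "?N = M + 2"
      by (metis add.commute le_Suc_ex not_less)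
    have "qint (M + 2) = 1 + t * qint M + t ^ (M + 1)"
      using qint_add[of "M + 1" 1] qint_Suc[of M] by simp
    then show ?thesis
      by (simp add: N mult.assoc)
  qed (simp add: nonedge_weight_eq_0)
  then have "t * single_removal 2 5 nonedge_weight x = t * (qint (?N - 2) * ?\<pi> + (1 - t\<^sup>2) * ?\<mu>)"
    unfolding t_mult_single_removal_nonedge_weight single_removal_one[OF assms] distrib_left
      mult.left_commute[of t "1 - t\<^sup>2"] nonedge_weight_square[OF assms, symmetric]
    by (simp add: algebra_simps power2_eq_square)
  then show ?thesis
    by simp
qed

lemma pair_removal_nonedge_weight:
  assumes "x 0 \<le> 1" "x 4 \<le> 1"
  shows "pair_removal 2 5 nonedge_weight x = (1 + t) * nonedge_pair_weight x"
proof -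
  have "x 0 = 0 \<or> x 0 = 1" "x 4 = 0 \<or> x 4 = 1"
    using assms by linarith+
  then show ?thesis
    by (cases "x 1"; cases "x 3"; elim disjE)
      (simp_all add: pair_removal_2_5 nonedge_weight_def nonedge_pair_weight_def power_add mult_2 algebra_simps
        del: One_nat_def)
qed

lemma single_removal_nonedge_pair_weight:
  assumes "x 0 \<le> 1" "x 4 \<le> 1"
  shows "single_removal 2 5 nonedge_pair_weight x = qint (sum x {..<5} - 4) * nonedge_pair_weight x"
proof (cases "x 0 = 0 \<or> x 1 = 0 \<or> x 3 = 0 \<or> x 4 = 0")
  case True
  then show ?thesis
    by (auto simp: single_removal_2_5 nonedge_pair_weight_def)
next
  case False
  let ?\<mu> = "nonedge_pair_weight x"
  from False assms obtain i j where x: "x 0 = 1" "x 1 = Suc i" "x 3 = Suc j" "x 4 = 1"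
    by (metis One_nat_def le_Suc_eq le_zero_eq not0_implies_Suc)
  have "t * qint (Suc i) * nonedge_pair_weight (x(1 := i)) = qint i * ?\<mu>"
    by (simp add: x nonedge_pair_weight_def del: One_nat_def)
  moreover have "t ^ (1 + Suc i) * qint (x 2) * nonedge_pair_weight (x(2 := x 2 - 1)) = t ^ i * qint (x 2) * ?\<mu>"
    by (cases "x 2") (simp_all add: x nonedge_pair_weight_def power_add power3_eq_cube del: One_nat_def)
  moreover have "t ^ (Suc i + x 2) * qint (Suc j) * nonedge_pair_weight (x(3 := j)) = t ^ (i + x 2) * qint j * ?\<mu>"
    by (simp add: x nonedge_pair_weight_def power_add del: One_nat_def)
  moreover have "nonedge_pair_weight (x(0 := 0)) = 0" "nonedge_pair_weight (x(4 := 0)) = 0"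
    by (simp_all add: nonedge_pair_weight_def)
  moreover have "sum x {..<5} - 4 = i + x 2 + j"
    by (simp add: sum_lessThan_5 x del: One_nat_def)
  ultimately show ?thesis
    by (simp add: single_removal_2_5 x qint_add distrib_right del: One_nat_def power_Suc)
qed

lemma pair_removal_nonedge_pair_weight:
  assumes "x 0 \<le> 1" "x 4 \<le> 1"
  shows "pair_removal 2 5 nonedge_pair_weight x = 0"
  using assms by (simp add: pair_removal_2_5 nonedge_pair_weight_def)

subsection \<open>The expansion by non-edges\<close>

definition complete_series :: "nat \<Rightarrow> rat poly series" where
  "complete_series N \<alpha> = qfact N * elem_part [N, 0] \<alpha>"

definition nonedge_series :: "nat \<Rightarrow> rat poly series" where
  "nonedge_series N \<alpha> = qfact (N - 2) * (elem_part [N - 1, 1] \<alpha> - qint N * elem_part [N, 0] \<alpha>)"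

definition nonedge_pair_series :: "nat \<Rightarrow> rat poly series" where
  "nonedge_pair_series N \<alpha> = qfact (N - 4) *
     ((1 + t) * elem_part [N - 2, 2] \<alpha> - (1 + t) * qint (N - 2) * elem_part [N - 1, 1] \<alpha>
      + t * qint N * qint (N - 3) * elem_part [N, 0] \<alpha>)"

lemma complete_series_fun_upd:
  assumes "\<alpha> c = 0"
  shows "complete_series N (\<alpha>(c := 1)) = qint N * complete_series (N - 1) \<alpha>"
    and "complete_series N (\<alpha>(c := 2)) = 0"
    and "3 \<le> m \<Longrightarrow> complete_series N (\<alpha>(c := m)) = 0"
  using assms
  by (cases N; simp add: complete_series_def elem_part_pair_fun_upd_1[of \<alpha> c] elem_part_pair_fun_upd_2[of \<alpha> c]
      elem_part_pair_fun_upd_ge_3[of \<alpha> c] mult_ac del: One_nat_def)+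

lemma nonedge_series_fun_upd_1:
  assumes "\<alpha> c = 0" "2 \<le> N"
  shows "nonedge_series N (\<alpha>(c := 1)) = (1 - t) * complete_series (N - 1) \<alpha> + qint (N - 2) * nonedge_series (N - 1) \<alpha>"
proof -
  note upd = elem_part_pair_fun_upd_1[of \<alpha> c, OF assms(1), simplified]
  obtain M where N: "N = 2 + M"
    using assms(2) le_Suc_ex by blast
  show ?thesis
  proof (cases M)
    case 0
    then show ?thesis
      using elem_part_pair_commute[of 0 1, where 'a = "rat poly"]
      by (simp add: nonedge_series_def complete_series_def N eval_nat_numeral upd qint_Suc algebra_simps)
  next
    case (Suc K)
    then show ?thesis
      by (simp add: nonedge_series_def complete_series_def N eval_nat_numeral upd qint_Suc algebra_simps)
  qed
qed

lemma nonedge_series_fun_upd_2: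
  assumes "\<alpha> c = 0" "2 \<le> N"
  shows "nonedge_series N (\<alpha>(c := 2)) = complete_series (N - 2) \<alpha>"
proof -
  obtain M where "N = 2 + M"
    using assms(2) le_Suc_ex by blast
  then show ?thesis
    by (simp add: nonedge_series_def complete_series_def elem_part_pair_fun_upd_2[of \<alpha> c, OF assms(1)]
        del: One_nat_def)
qed

lemma nonedge_series_fun_upd_ge_3:
  assumes "\<alpha> c = 0" "3 \<le> m"
  shows "nonedge_series N (\<alpha>(c := m)) = 0"
  by (simp add: nonedge_series_def elem_part_pair_fun_upd_ge_3[of \<alpha> c, OF assms])

lemma nonedge_pair_series_fun_upd_1:
  assumes "\<alpha> c = 0" "4 \<le> N"
  shows "nonedge_pair_series N (\<alpha>(c := 1))
    = (1 - t\<^sup>2) * nonedge_series (N - 1) \<alpha> + qint (N - 4) * nonedge_pair_series (N - 1) \<alpha>"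
proof -
  note upd = elem_part_pair_fun_upd_1[of \<alpha> c, OF assms(1), simplified]
  obtain M where N: "N = 4 + M"
    using assms(2) le_Suc_ex by blast
  show ?thesis
  proof (cases M)
    case 0
    then show ?thesis
      using elem_part_pair_commute[of 1 2, where 'a = "rat poly"]
      by (simp add: nonedge_series_def nonedge_pair_series_def N eval_nat_numeral upd qint_Suc algebra_simps)
  next
    case (Suc K)
    then show ?thesis
      by (simp add: nonedge_series_def nonedge_pair_series_def N eval_nat_numeral upd qint_Suc algebra_simps)
  qed
qed

lemma nonedge_pair_series_fun_upd_2:
  assumes "\<alpha> c = 0" "4 \<le> N"
  shows "nonedge_pair_series N (\<alpha>(c := 2)) = (1 + t) * nonedge_series (N - 2) \<alpha>"
proof -
  obtain M where "N = 4 + M"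
    using assms(2) le_Suc_ex by blast
  then show ?thesis
    by (simp add: nonedge_series_def nonedge_pair_series_def algebra_simps
        elem_part_pair_fun_upd_2[of \<alpha> c, OF assms(1), simplified])
qed

lemma nonedge_pair_series_fun_upd_ge_3:
  assumes "\<alpha> c = 0" "3 \<le> m"
  shows "nonedge_pair_series N (\<alpha>(c := m)) = 0"
  by (simp add: nonedge_pair_series_def elem_part_pair_fun_upd_ge_3[of \<alpha> c, OF assms])

definition nonedge_expansion :: "(nat \<Rightarrow> nat) \<Rightarrow> rat poly series" where
  "nonedge_expansion x \<alpha> = complete_series (sum x {..<5}) \<alpha>
     + nonedge_weight x * nonedge_series (sum x {..<5}) \<alpha>
     + nonedge_pair_weight x * nonedge_pair_series (sum x {..<5}) \<alpha>"

lemma sum_fun_upd_pred: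
  fixes x :: "'a \<Rightarrow> nat"
  assumes "finite A" "p \<in> A" "0 < x p"
  shows "sum (x(p := x p - 1)) A = sum x A - 1"
  using assms by (simp add: sum.remove[of A p])

lemma single_removal_nonedge_expansion:
  fixes x :: "nat \<Rightarrow> nat"
  defines "N \<equiv> sum x {..<5} - 1"
  shows "single_removal 2 5 (\<lambda>x. nonedge_expansion x \<alpha>) x
    = complete_series N \<alpha> * single_removal 2 5 (\<lambda>_. 1) x
      + nonedge_series N \<alpha> * single_removal 2 5 nonedge_weight x
      + nonedge_pair_series N \<alpha> * single_removal 2 5 nonedge_pair_weight x"
proof -
  let ?w = "\<lambda>p. t ^ below 2 x p * qint (x p)" and ?x = "\<lambda>p. x(p := x p - 1)"
  have "?w p * nonedge_expansion (?x p) \<alpha> = complete_series N \<alpha> * (?w p * 1)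
      + nonedge_series N \<alpha> * (?w p * nonedge_weight (?x p))
      + nonedge_pair_series N \<alpha> * (?w p * nonedge_pair_weight (?x p))" if "p < 5" for p
  proof (cases "x p = 0")
    case False
    with that have "sum (?x p) {..<5} = N"
      unfolding N_def by (intro sum_fun_upd_pred) auto
    then show ?thesis
      unfolding nonedge_expansion_def by (simp only: algebra_simps)
  qed simp
  then show ?thesis
    by (simp add: single_removal_def sum.distrib sum_distrib_left)
qed

lemma pair_removal_nonedge_expansion:
  fixes x :: "nat \<Rightarrow> nat"
  defines "N \<equiv> sum x {..<5} - 2"
  shows "pair_removal 2 5 (\<lambda>x. nonedge_expansion x \<alpha>) x
    = complete_series N \<alpha> * pair_removal 2 5 (\<lambda>_. 1) x
      + nonedge_series N \<alpha> * pair_removal 2 5 nonedge_weight x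
      + nonedge_pair_series N \<alpha> * pair_removal 2 5 nonedge_pair_weight x"
proof -
  let ?w = "\<lambda>p q. (t ^ below 2 x p * qint (x p)) * (t ^ below 2 x q * qint (x q))"
  let ?x = "\<lambda>p q. x(p := x p - 1, q := x q - 1)"
  have "?w p q * nonedge_expansion (?x p q) \<alpha> = complete_series N \<alpha> * (?w p q * 1)
      + nonedge_series N \<alpha> * (?w p q * nonedge_weight (?x p q))
      + nonedge_pair_series N \<alpha> * (?w p q * nonedge_pair_weight (?x p q))"
    if "p + 2 < q \<and> q < 5" for p q
  proof (cases "x p = 0 \<or> x q = 0")
    case False
    with that have "sum (?x p q) {..<5} = N"
      unfolding N_def
      using sum_fun_upd_pred[of "{..<5}" p x] sum_fun_upd_pred[of "{..<5}" q "x(p := x p - 1)"] by simp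
    then show ?thesis
      unfolding nonedge_expansion_def by (simp only: algebra_simps)
  qed auto
  then show ?thesis
    unfolding pair_removal_def sum_distrib_left sum.distrib[symmetric] split_def
    by (intro sum.cong) auto
qed

lemma nonedge_expansion_fun_upd_1:
  assumes "x 0 \<le> 1" "x 4 \<le> 1" "\<alpha> c = 0"
  shows "nonedge_expansion x (\<alpha>(c := 1)) = single_removal 2 5 (\<lambda>x. nonedge_expansion x \<alpha>) x"
proof -
  let ?N = "sum x {..<5}" and ?\<pi> = "nonedge_weight x" and ?\<mu> = "nonedge_pair_weight x"
  have "complete_series ?N (\<alpha>(c := 1)) = qint ?N * complete_series (?N - 1) \<alpha>"
    using assms(3) by (rule complete_series_fun_upd)
  moreover have "?\<pi> * nonedge_series ?N (\<alpha>(c := 1)) =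
      ?\<pi> * ((1 - t) * complete_series (?N - 1) \<alpha> + qint (?N - 2) * nonedge_series (?N - 1) \<alpha>)"
    using nonedge_series_fun_upd_1[of \<alpha> c, OF assms(3), of ?N]
    by (cases "?N < 2") (simp_all add: nonedge_weight_eq_0)
  moreover have "?\<mu> * nonedge_pair_series ?N (\<alpha>(c := 1)) =
      ?\<mu> * ((1 - t\<^sup>2) * nonedge_series (?N - 1) \<alpha> + qint (?N - 4) * nonedge_pair_series (?N - 1) \<alpha>)"
    using nonedge_pair_series_fun_upd_1[of \<alpha> c, OF assms(3), of ?N]
    by (cases "?N < 4") (simp_all add: nonedge_pair_weight_eq_0)
  ultimately show ?thesis
    unfolding single_removal_nonedge_expansion single_removal_one[OF assms(1,2)]
      single_removal_nonedge_weight[OF assms(1,2)] single_removal_nonedge_pair_weight[OF assms(1,2)]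
    unfolding nonedge_expansion_def by (simp add: algebra_simps)
qed

lemma nonedge_expansion_fun_upd_2:
  assumes "x 0 \<le> 1" "x 4 \<le> 1" "\<alpha> c = 0"
  shows "nonedge_expansion x (\<alpha>(c := 2)) = pair_removal 2 5 (\<lambda>x. nonedge_expansion x \<alpha>) x"
proof -
  let ?N = "sum x {..<5}" and ?\<pi> = "nonedge_weight x" and ?\<mu> = "nonedge_pair_weight x"
  have "complete_series ?N (\<alpha>(c := 2)) = 0"
    using assms(3) by (rule complete_series_fun_upd)
  moreover have "?\<pi> * nonedge_series ?N (\<alpha>(c := 2)) = ?\<pi> * complete_series (?N - 2) \<alpha>"
    using nonedge_series_fun_upd_2[of \<alpha> c, OF assms(3), of ?N]
    by (cases "?N < 2") (simp_all add: nonedge_weight_eq_0)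
  moreover have "?\<mu> * nonedge_pair_series ?N (\<alpha>(c := 2)) = ?\<mu> * ((1 + t) * nonedge_series (?N - 2) \<alpha>)"
    using nonedge_pair_series_fun_upd_2[of \<alpha> c, OF assms(3), of ?N]
    by (cases "?N < 4") (simp_all add: nonedge_pair_weight_eq_0)
  ultimately show ?thesis
    unfolding pair_removal_nonedge_expansion pair_removal_one
      pair_removal_nonedge_weight[OF assms(1,2)] pair_removal_nonedge_pair_weight[OF assms(1,2)]
    unfolding nonedge_expansion_def by (simp only: mult_ac add_0 mult_zero_left mult_zero_right add_0_right)
qed

lemma nonedge_expansion_fun_upd_ge_3:
  assumes "\<alpha> c = 0" "3 \<le> m"
  shows "nonedge_expansion x (\<alpha>(c := m)) = 0"
  by (simp add: nonedge_expansion_def complete_series_fun_upd(3)[of \<alpha> c, OF assms]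
      nonedge_series_fun_upd_ge_3[of \<alpha> c, OF assms] nonedge_pair_series_fun_upd_ge_3[of \<alpha> c, OF assms])

lemma nonedge_expansion_empty_support: "nonedge_expansion x (\<lambda>_. 0) = (if sum x {..<5} = 0 then 1 else 0)"
proof -
  have "nonedge_weight x = 0 \<and> nonedge_pair_weight x = 0" if "sum x {..<5} = 0"
    using that by (simp add: nonedge_weight_eq_0 nonedge_pair_weight_eq_0 del: sum_eq_0_iff)
  then show ?thesis
    by (simp add: nonedge_expansion_def complete_series_def nonedge_series_def nonedge_pair_series_def
        elem_part_pair_empty_support)
qed

lemma nonedge_expansion_infinite_support: "infinite {c. \<alpha> c \<noteq> 0} \<Longrightarrow> nonedge_expansion x \<alpha> = 0"
  by (simp add: nonedge_expansion_def complete_series_def nonedge_series_def nonedge_pair_series_def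
      elem_part_pair_infinite_support)

lemma finite_support_top_cases:
  fixes \<alpha> :: "nat \<Rightarrow> nat"
  obtains (infinite) "infinite {c. \<alpha> c \<noteq> 0}" | (zero) "\<alpha> = (\<lambda>_. 0)"
    | (top) \<beta> c k where "\<alpha> = \<beta>(c := k)" "0 < k" "\<forall>c'\<ge>c. \<beta> c' = 0"
proof (cases "finite {c. \<alpha> c \<noteq> 0} \<and> \<alpha> \<noteq> (\<lambda>_. 0)")
  case True
  define c where "c = Max {c. \<alpha> c \<noteq> 0}"
  have "{c. \<alpha> c \<noteq> 0} \<noteq> {}"
    using True by auto
  with True have "0 < \<alpha> c"
    using Max_in[of "{c. \<alpha> c \<noteq> 0}"] by (auto simp: c_def)
  moreover have "\<alpha> c' = 0" if "c < c'" for c'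
    using True that Max_ge[of "{c. \<alpha> c \<noteq> 0}" c'] unfolding c_def by (metis (mono_tags) mem_Collect_eq not_less)
  ultimately show thesis
    by (intro top[of "\<alpha>(c := 0)" c "\<alpha> c"]) auto
qed (use infinite zero in blast)

locale five_block_graph = block_graph S E blk 2 5
  for S :: "nat set" and E :: "nat \<Rightarrow> nat \<Rightarrow> bool" and blk :: "nat \<Rightarrow> nat" +
  assumes first_block: "block_sizes S 0 \<le> 1" and last_block: "block_sizes S 4 \<le> 1"
begin

lemma chrom_qsf_fun_upd_eq_nonedge_expansion:
  assumes V: "V \<subseteq> S" and \<beta>: "\<forall>c'\<ge>c. \<beta> c' = 0" and "0 < k"
    and remove: "\<And>C. C \<subseteq> V \<Longrightarrow> C \<noteq> {} \<Longrightarrow>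
      chrom_qsf (V - C) E \<beta> = nonedge_expansion (block_sizes (V - C)) \<beta>"
  shows "chrom_qsf V E (\<beta>(c := k)) = nonedge_expansion (block_sizes V) (\<beta>(c := k))"
proof -
  have ends: "block_sizes V 0 \<le> 1" "block_sizes V 4 \<le> 1"
    using block_sizes_mono[OF V subset_refl] first_block last_block le_trans by blast+
  have \<beta>_c: "\<beta> c = 0"
    using \<beta> by simp
  consider "k = 1" | "k = 2" | "3 \<le> k"
    using \<open>0 < k\<close> by linarith
  then show ?thesis
  proof cases
    case 1
    show ?thesis
      unfolding 1 nonedge_expansion_fun_upd_1[where \<alpha> = \<beta> and c = c, OF ends \<beta>_c]
      using remove by (intro chrom_qsf_top_single V \<beta>) simp
  next
    case 2
    show ?thesis
      unfolding 2 nonedge_expansion_fun_upd_2[where \<alpha> = \<beta> and c = c, OF ends \<beta>_c]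
      using remove by (intro chrom_qsf_top_pair V \<beta>) simp
  next
    case 3
    then have "chrom_qsf V E (\<beta>(c := k)) = 0"
      using \<beta> by (intro chrom_qsf_top_large[OF V, of c]) auto
    then show ?thesis
      using nonedge_expansion_fun_upd_ge_3[where \<alpha> = \<beta> and c = c, OF \<beta>_c 3] by simp
  qed
qed

lemma chrom_qsf_eq_nonedge_expansion:
  assumes "V \<subseteq> S"
  shows "chrom_qsf V E \<alpha> = nonedge_expansion (block_sizes V) \<alpha>"
  using assms
proof (induction "card V" arbitrary: V \<alpha> rule: less_induct)
  case less
  note V = less.prems
  have fin: "finite V"
    using V by (rule finite_subset_vertices)
  show ?case
  proof (cases \<alpha> rule: finite_support_top_cases)
    case infinite
    then show ?thesis
      by (simp add: chrom_qsf_infinite_support[OF fin] nonedge_expansion_infinite_support)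
  next
    case zero
    then show ?thesis
      using sum_block_sizes[OF V] fin by (simp add: chrom_qsf_empty_support nonedge_expansion_empty_support)
  next
    case (top \<beta> c k)
    have "chrom_qsf (V - C) E \<beta> = nonedge_expansion (block_sizes (V - C)) \<beta>" if "C \<subseteq> V" "C \<noteq> {}" for C
      using that fin V by (intro less.hyps psubset_card_mono) auto
    then show ?thesis
      unfolding top(1) by (intro chrom_qsf_fun_upd_eq_nonedge_expansion[OF V top(3,2)])
  qed
qed

end

subsection \<open>The coefficients in the elementary basis\<close>

definition elem_coeff_0 :: "nat \<Rightarrow> nat \<Rightarrow> nat \<Rightarrow> rat poly" where
  "elem_coeff_0 n r s = qint n * qint (n - 3) * qint (r - 1) * qint (n - s - 1)"

definition elem_coeff_1 :: "nat \<Rightarrow> nat \<Rightarrow> nat \<Rightarrow> rat poly" where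
  "elem_coeff_1 n r s = smult (1/2) (qint (n - 2) *
     ((t ^ (r - 1) + t ^ (n - s - 1)) * qint (n - 3)
      + t ^ (n - s - 1) * qint 2 * qint (r - 2) * qint (s - 1)
      + t ^ (r - 1) * qint 2 * qint (n - r - 1) * qint (n - s - 2)))"

definition elem_coeff_2 :: "nat \<Rightarrow> nat \<Rightarrow> nat \<Rightarrow> rat poly" where
  "elem_coeff_2 n r s = t ^ (n + r - s - 3) * qint 2 * qint (n - r - 1) * qint (s - 1)"

lemma parameter_differences:
  fixes n r s :: nat
  assumes "2 \<le> s" "s \<le> r" "r + 2 \<le> n"
  obtains i b j where "s = i + 2" "r = i + b + 2" "n = i + b + j + 4"
proof -
  have "s = (s - 2) + 2" "r = (s - 2) + (r - s) + 2" "n = (s - 2) + (r - s) + (n - r - 2) + 4"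
    using assms by linarith+
  then show thesis using that by blast
qed

lemma qint_identity_elem_coeff_0:
  "qint (a + b + k) * (qint (a + b + k + 1) - (t ^ (b + k) * qint (1 + a) + t ^ (a + b) * qint k))
     + t ^ (a + 2 * b + k) * qint a * qint k
   = qint (a + b) * qint (b + k)"
  unfolding qint_add qint_1 mult_2 power_add power_one_right power_t_eq_qint[of a] power_t_eq_qint[of b]
    power_t_eq_qint[of k]
  by algebra

lemma qint_identity_elem_coeff_1:
  "2 * (qint (i + b + j + 1) * (t ^ (b + j + 1) * qint (i + 2) + t ^ (i + b + 1) * qint (j + 1))
     - (1 + t) * t ^ (i + 2 * b + j + 1) * qint (i + 1) * qint (j + 1))
   = (t ^ (i + b + 1) + t ^ (b + j + 1)) * qint (i + b + j + 1)
      + t ^ (b + j + 1) * qint 2 * qint (i + b) * qint (i + 1)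
      + t ^ (i + b + 1) * qint 2 * qint (j + 1) * qint (b + j)"
  unfolding qint_2 qint_add qint_1 mult_2 power_add power_one_right power_t_eq_qint[of i] power_t_eq_qint[of b]
    power_t_eq_qint[of j]
  by algebra

lemma elem_coeffs_eq_weights:
  assumes "2 \<le> s" "s \<le> r" "r + 2 \<le> n"
    and x: "x 0 = 1" "x 1 = s - 1" "x 2 = r - s" "x 3 = n - r - 1" "x 4 = 1"
  shows "elem_coeff_0 n r s = qint n * qint (n - 3) *
      (qint (n - 2) * (qint (n - 1) - nonedge_weight x) + t * nonedge_pair_weight x)"
    and "elem_coeff_1 n r s = qint (n - 2) * (qint (n - 3) * nonedge_weight x - (1 + t) * nonedge_pair_weight x)"
    and "elem_coeff_2 n r s = (1 + t) * nonedge_pair_weight x"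
proof -
  obtain i b j where srn: "s = i + 2" "r = i + b + 2" "n = i + b + j + 4"
    using assms(1-3) by (rule parameter_differences)
  have diffs: "n - 1 = i + b + j + 3" "n - 2 = i + b + j + 2" "n - 3 = i + b + j + 1" "n - s - 1 = b + j + 1"
    "n - s - 2 = b + j" "n - r - 1 = j + 1" "r - 1 = i + b + 1" "r - 2 = i + b" "s - 1 = i + 1" "r - s = b"
    "n + r - s - 3 = i + 2 * b + j + 1"
    unfolding srn by simp_all
  have nonedge: "nonedge_weight x = t ^ (b + j + 1) * qint (i + 2) + t ^ (i + b + 1) * qint (j + 1)"
    unfolding nonedge_weight_def x diffs by (simp add: add_ac)
  have pair: "nonedge_pair_weight x = t ^ (i + 2 * b + j + 1) * qint (i + 1) * qint (j + 1)"
    unfolding nonedge_pair_weight_def x diffs by (simp add: add_ac)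
  show "elem_coeff_0 n r s = qint n * qint (n - 3) *
      (qint (n - 2) * (qint (n - 1) - nonedge_weight x) + t * nonedge_pair_weight x)"
    using qint_identity_elem_coeff_0[of "i + 1" b "j + 1"]
    unfolding elem_coeff_0_def nonedge pair diffs by (simp add: algebra_simps eval_nat_numeral)
  have half: "smult (1 / 2) q = p" if "2 * p = q" for p q :: "rat poly"
    using that by (auto simp: numeral_poly)
  have "smult (1 / 2) ((t ^ (r - 1) + t ^ (n - s - 1)) * qint (n - 3)
      + t ^ (n - s - 1) * qint 2 * qint (r - 2) * qint (s - 1)
      + t ^ (r - 1) * qint 2 * qint (n - r - 1) * qint (n - s - 2))
      = qint (n - 3) * nonedge_weight x - (1 + t) * nonedge_pair_weight x"
    unfolding nonedge pair diffs mult.assoc[symmetric] by (rule half) (rule qint_identity_elem_coeff_1)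
  then show "elem_coeff_1 n r s = qint (n - 2) * (qint (n - 3) * nonedge_weight x - (1 + t) * nonedge_pair_weight x)"
    unfolding elem_coeff_1_def mult_smult_right[symmetric] by (rule arg_cong)
  show "elem_coeff_2 n r s = (1 + t) * nonedge_pair_weight x"
    unfolding elem_coeff_2_def pair diffs qint_2 by (simp add: mult_ac)
qed

lemma nonedge_expansion_eq_elem_coeffs:
  assumes "2 \<le> s" "s \<le> r" "r + 2 \<le> n"
    and x: "x 0 = 1" "x 1 = s - 1" "x 2 = r - s" "x 3 = n - r - 1" "x 4 = 1"
  shows "nonedge_expansion x \<alpha> = qfact (n - 4) * (elem_coeff_0 n r s * elem_part [n] \<alpha>
    + elem_coeff_1 n r s * elem_part [n - 1, 1] \<alpha> + elem_coeff_2 n r s * elem_part [n - 2, 2] \<alpha>)"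
proof -
  have N: "sum x {..<5} = n"
    using assms by (simp add: sum_lessThan_5 del: One_nat_def)
  define q where "q = qfact (n - 4)"
  obtain M where "n = 4 + M"
    using assms(1-3) le_Suc_ex[of 4 n] by force
  then have fact: "qfact (n - 2) = qint (n - 2) * qint (n - 3) * q" "qfact n = qint n * qint (n - 1) * qfact (n - 2)"
    by (simp_all add: q_def eval_nat_numeral mult_ac)
  show ?thesis
    unfolding nonedge_expansion_def N complete_series_def nonedge_series_def nonedge_pair_series_def fact
      q_def[symmetric] elem_coeffs_eq_weights[of s r n x, OF assms] elem_part_pair_0
    by algebra
qed

lemma palindromic_unimodal_elem_coeff_0:
  assumes "2 \<le> s" "s \<le> r" "r + 2 \<le> n"
  shows "palindromic_unimodal (3 * n + r - s - 9) (elem_coeff_0 n r s)"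
proof -
  obtain i b j where srn: "s = i + 2" "r = i + b + 2" "n = i + b + j + 4"
    using assms by (rule parameter_differences)
  have "palindromic_unimodal (b + j + (i + b) + (i + b + j) + (i + b + j + 3))
      (qint (Suc (i + b + j + 3)) * (qint (Suc (i + b + j)) * (qint (Suc (i + b)) * qint (Suc (b + j)))))"
    by (intro palindromic_unimodal_qint_mult palindromic_unimodal.qint)
  moreover have "b + j + (i + b) + (i + b + j) + (i + b + j + 3) = 3 * n + r - s - 9"
    "Suc (i + b + j + 3) = n" "Suc (i + b + j) = n - 3" "Suc (i + b) = r - 1" "Suc (b + j) = n - s - 1"
    by (simp_all add: srn)
  ultimately show ?thesis
    by (simp only: elem_coeff_0_def mult.assoc)
qed

lemma power_t_add_power_t_mult_qint:
  "(t ^ i + t ^ j) * qint (i + b + j + 1) = t ^ i * qint (b + 2 * j + 1) + t ^ j * qint (b + 2 * i + 1)"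
  unfolding qint_add qint_1 mult_2 power_add power_one_right power_t_eq_qint[of i] power_t_eq_qint[of b]
    power_t_eq_qint[of j]
  by algebra

lemma palindromic_unimodal_power_t_add_power_t_mult_qint:
  "palindromic_unimodal (b + 2 * i + 2 * j) ((t ^ i + t ^ j) * qint (i + b + j + 1))"
proof -
  have "palindromic_unimodal (b + 2 * j + 2 * i) (t ^ i * qint (Suc (b + 2 * j)))"
    "palindromic_unimodal (b + 2 * i + 2 * j) (t ^ j * qint (Suc (b + 2 * i)))"
    by (intro palindromic_unimodal_power_t_mult palindromic_unimodal.qint)+
  then show ?thesis
    unfolding power_t_add_power_t_mult_qint by (simp add: palindromic_unimodal.add add_ac)
qed

lemma palindromic_unimodal_power_t_qint_mult_qint:
  "palindromic_unimodal (k + h + 2 * l) (t ^ l * qint 2 * qint (k + 1) * qint h)"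
proof (cases h)
  case (Suc g)
  have "palindromic_unimodal (g + k + 1 + 2 * l) (t ^ l * (qint (Suc 1) * (qint (Suc k) * qint (Suc g))))"
    by (intro palindromic_unimodal_power_t_mult palindromic_unimodal_qint_mult palindromic_unimodal.qint)
  then show ?thesis
    by (simp add: Suc mult.assoc numeral_2_eq_2 add_ac)
qed (simp add: palindromic_unimodal.zero)

lemma palindromic_unimodal_elem_coeff_1:
  assumes "2 \<le> s" "s \<le> r" "r + 2 \<le> n"
  shows "palindromic_unimodal (3 * n + r - s - 9) (elem_coeff_1 n r s)"
proof -
  obtain i b j where srn: "s = i + 2" "r = i + b + 2" "n = i + b + j + 4"
    using assms by (rule parameter_differences)
  define d where "d = 2 * i + 3 * b + 2 * j + 2"
  have "palindromic_unimodal (b + 2 * i + 2 * j + 2 * (b + 1)) (t ^ (b + 1) * ((t ^ i + t ^ j) * qint (i + b + j + 1)))"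
    by (intro palindromic_unimodal_power_t_mult palindromic_unimodal_power_t_add_power_t_mult_qint)
  moreover have "b + 2 * i + 2 * j + 2 * (b + 1) = d"
    by (simp add: d_def)
  ultimately have "palindromic_unimodal d ((t ^ (i + b + 1) + t ^ (b + j + 1)) * qint (i + b + j + 1))"
    by (simp add: power_add algebra_simps)
  moreover have "palindromic_unimodal d (t ^ (b + j + 1) * qint 2 * qint (i + 1) * qint (i + b))"
    using palindromic_unimodal_power_t_qint_mult_qint[of i "i + b" "b + j + 1"] by (simp add: d_def algebra_simps)
  moreover have "palindromic_unimodal d (t ^ (i + b + 1) * qint 2 * qint (j + 1) * qint (b + j))"
    using palindromic_unimodal_power_t_qint_mult_qint[of j "b + j" "i + b + 1"] by (simp add: d_def algebra_simps)
  ultimately have "palindromic_unimodal (d + (i + b + j + 1)) (smult (1 / 2) (qint (Suc (i + b + j + 1)) *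
      ((t ^ (i + b + 1) + t ^ (b + j + 1)) * qint (i + b + j + 1)
       + t ^ (b + j + 1) * qint 2 * qint (i + 1) * qint (i + b)
       + t ^ (i + b + 1) * qint 2 * qint (j + 1) * qint (b + j))))"
    by (intro palindromic_unimodal.smult palindromic_unimodal_qint_mult palindromic_unimodal.add) simp_all
  moreover have "d + (i + b + j + 1) = 3 * n + r - s - 9" "Suc (i + b + j + 1) = n - 2" "i + b + j + 1 = n - 3"
    "i + b + 1 = r - 1" "b + j + 1 = n - s - 1" "i + 1 = s - 1" "i + b = r - 2" "j + 1 = n - r - 1" "b + j = n - s - 2"
    by (simp_all add: d_def srn)
  ultimately show ?thesis
    by (simp only: elem_coeff_1_def mult_ac)
qed

lemma palindromic_unimodal_elem_coeff_2:
  assumes "2 \<le> s" "s \<le> r" "r + 2 \<le> n"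
  shows "palindromic_unimodal (3 * n + r - s - 9) (elem_coeff_2 n r s)"
proof -
  obtain i b j where srn: "s = i + 2" "r = i + b + 2" "n = i + b + j + 4"
    using assms by (rule parameter_differences)
  have "palindromic_unimodal (j + (i + 1) + 2 * (i + 2 * b + j + 1)) (t ^ (i + 2 * b + j + 1) * qint 2 * qint (j + 1) * qint (i + 1))"
    by (rule palindromic_unimodal_power_t_qint_mult_qint)
  moreover have "j + (i + 1) + 2 * (i + 2 * b + j + 1) = 3 * n + r - s - 9"
    "i + 2 * b + j + 1 = n + r - s - 3" "j + 1 = n - r - 1" "i + 1 = s - 1"
    by (simp_all add: srn)
  ultimately show ?thesis
    by (simp only: elem_coeff_2_def)
qed

lemma twice_center_of_symmetry:
  assumes "2 \<le> s" "s \<le> r" "r + 2 \<le> n"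
  shows "of_nat (((n - 4) choose 2) + (3 * n + r - s - 9))
    = 2 * ((of_int (int (n choose 2)) - of_int (int n - int r + int s - 1)) / 2 :: rat)"
proof -
  obtain i b j where srn: "s = i + 2" "r = i + b + 2" "n = i + b + j + 4"
    using assms by (rule parameter_differences)
  have "(N + 4) choose 2 = (N choose 2) + 4 * N + 6" for N :: nat
    by (simp add: numeral_eq_Suc)
  then show ?thesis
    by (simp add: srn)
qed

subsection \<open>The natural unit interval order\<close>

definition vertex_block :: "nat \<Rightarrow> nat \<Rightarrow> nat \<Rightarrow> nat \<Rightarrow> nat" where
  "vertex_block n r s v =
     (if v \<le> 1 then 0 else if v \<le> s then 1 else if v \<le> r then 2 else if v < n then 3 else 4)"

lemma inc_edge_iff_vertex_block:
  assumes "2 \<le> s" "s \<le> r" "r + 2 \<le> n"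
    and m: "m 1 = r" "\<And>i. 2 \<le> i \<Longrightarrow> i \<le> s \<Longrightarrow> m i = n - 1" "\<And>i. s + 1 \<le> i \<Longrightarrow> i \<le> n - 1 \<Longrightarrow> m i = n"
    and uv: "1 \<le> u" "u < v" "v \<le> n"
  shows "inc_edge n m u v \<longleftrightarrow> vertex_block n r s v \<le> vertex_block n r s u + 2"
proof -
  have "u \<le> m v" if "v < n"
  proof -
    consider "2 \<le> v" "v \<le> s" | "s + 1 \<le> v"
      using uv by linarith
    then show ?thesis
      using that m(2)[of v] m(3)[of v] uv by cases auto
  qed
  moreover have "m u < v \<longleftrightarrow> vertex_block n r s u + 2 < vertex_block n r s v"
  proof -
    consider "u = 1" | "2 \<le> u" "u \<le> s" | "s + 1 \<le> u"
      using uv(1) by linarith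
    then show ?thesis
      using uv assms(1-3) m(1) m(2)[of u] m(3)[of u] by cases (auto simp: vertex_block_def)
  qed
  ultimately show ?thesis
    using uv by (auto simp: inc_edge_def nuio_less_def)
qed

lemma block_graph_inc_edge:
  assumes "2 \<le> s" "s \<le> r" "r + 2 \<le> n"
    and m: "m 1 = r" "\<And>i. 2 \<le> i \<Longrightarrow> i \<le> s \<Longrightarrow> m i = n - 1" "\<And>i. s + 1 \<le> i \<Longrightarrow> i \<le> n - 1 \<Longrightarrow> m i = n"
  shows "block_graph {1..n} (inc_edge n m) (vertex_block n r s) 2 5"
proof
  have mono: "vertex_block n r s u \<le> vertex_block n r s v" if "u < v" for u v
    using that by (simp add: vertex_block_def)
  then show "vertex_block n r s u \<le> vertex_block n r s v" if "u < v" for u v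
    using that .
  show "inc_edge n m u v \<longleftrightarrow>
      u \<noteq> v \<and> vertex_block n r s u \<le> vertex_block n r s v + 2 \<and> vertex_block n r s v \<le> vertex_block n r s u + 2"
    if "u \<in> {1..n}" "v \<in> {1..n}" for u v
  proof (cases u v rule: linorder_cases)
    case less
    then show ?thesis
      using inc_edge_iff_vertex_block[of s r n m u v, OF assms] mono[OF less] that by auto
  next
    case equal
    then show ?thesis by (simp add: inc_edge_def)
  next
    case greater
    have "inc_edge n m u v \<longleftrightarrow> inc_edge n m v u"
      by (auto simp: inc_edge_def)
    then show ?thesis
      using inc_edge_iff_vertex_block[of s r n m v u, OF assms] mono[OF greater] that greater by auto
  qed
qed (auto simp: vertex_block_def)

lemma chrom_qsf_inc_edge:
  assumes "2 \<le> s" "s \<le> r" "r + 2 \<le> n"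
    and m: "m 1 = r" "\<And>i. 2 \<le> i \<Longrightarrow> i \<le> s \<Longrightarrow> m i = n - 1" "\<And>i. s + 1 \<le> i \<Longrightarrow> i \<le> n - 1 \<Longrightarrow> m i = n"
  shows "chrom_qsf {1..n} (inc_edge n m) = (\<lambda>\<alpha>. qfact (n - 4) * (elem_coeff_0 n r s * elem_part [n] \<alpha>
    + elem_coeff_1 n r s * elem_part [n - 1, 1] \<alpha> + elem_coeff_2 n r s * elem_part [n - 2, 2] \<alpha>))"
proof
  fix \<alpha>
  interpret block_graph "{1..n}" "inc_edge n m" "vertex_block n r s" 2 5
    using assms by (rule block_graph_inc_edge)
  have "block {1..n} 0 = {1}" "block {1..n} 1 = {2..s}" "block {1..n} 2 = {s<..r}" "block {1..n} 3 = {r<..<n}"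
    "block {1..n} 4 = {n}"
    using assms(1-3) by (auto simp: block_def vertex_block_def split: if_splits)
  then have sizes: "block_sizes {1..n} 0 = 1" "block_sizes {1..n} 1 = s - 1" "block_sizes {1..n} 2 = r - s"
    "block_sizes {1..n} 3 = n - r - 1" "block_sizes {1..n} 4 = 1"
    by (simp_all add: block_sizes_def)
  interpret five_block_graph "{1..n}" "inc_edge n m" "vertex_block n r s"
    by unfold_locales (simp_all only: sizes order_refl)
  show "chrom_qsf {1..n} (inc_edge n m) \<alpha> = qfact (n - 4) * (elem_coeff_0 n r s * elem_part [n] \<alpha>
    + elem_coeff_1 n r s * elem_part [n - 1, 1] \<alpha> + elem_coeff_2 n r s * elem_part [n - 2, 2] \<alpha>)"
    unfolding chrom_qsf_eq_nonedge_expansion[OF subset_refl]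
    using assms(1-3) sizes by (rule nonedge_expansion_eq_elem_coeffs)
qed

theorem theorem4p5:
  fixes n r s :: nat and m :: "nat \<Rightarrow> nat"
  assumes "2 \<le> s" and "s \<le> r" and "r + 2 \<le> n"
    and "m 1 = r"
    and "\<And>i. 2 \<le> i \<Longrightarrow> i \<le> s \<Longrightarrow> m i = n - 1"
    and "\<And>i. s + 1 \<le> i \<Longrightarrow> i \<le> n - 1 \<Longrightarrow> m i = n"
  shows "chrom_qsf {1..n} (inc_edge n m) =
           (\<lambda>\<alpha>. qfact (n - 4) *
              (  (qint n * qint (n - 3) * qint (r - 1) * qint (n - s - 1)) * elem_part [n] \<alpha>
               + smult (1/2) (qint (n - 2) *
                   (  ([:0, 1:] ^ (r - 1) + [:0, 1:] ^ (n - s - 1)) * qint (n - 3)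
                    + [:0, 1:] ^ (n - s - 1) * qint 2 * qint (r - 2) * qint (s - 1)
                    + [:0, 1:] ^ (r - 1) * qint 2 * qint (n - r - 1) * qint (n - s - 2)))
                   * elem_part [n - 1, 1] \<alpha>
               + ([:0, 1:] ^ (n + r - s - 3) * qint 2 * qint (n - r - 1) * qint (s - 1))
                   * elem_part [n - 2, 2] \<alpha>))
         \<and> e_positive (chrom_qsf {1..n} (inc_edge n m))
         \<and> e_unimodal (chrom_qsf {1..n} (inc_edge n m))
              ((of_int (int (n choose 2)) - of_int (int n - int r + int s - 1)) / 2)"
    (is "?X = _ \<and> _ \<and> e_unimodal _ ?c")
proof -
  let ?L = "{[n], [n - 1, 1], [n - 2, 2]}" and ?d = "((n - 4) choose 2) + (3 * n + r - s - 9)"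
  define p where "p lam = qfact (n - 4) * (if lam = [n] then elem_coeff_0 n r s
    else if lam = [n - 1, 1] then elem_coeff_1 n r s else elem_coeff_2 n r s)" for lam
  have X: "?X = (\<lambda>\<alpha>. qfact (n - 4) * (elem_coeff_0 n r s * elem_part [n] \<alpha>
      + elem_coeff_1 n r s * elem_part [n - 1, 1] \<alpha> + elem_coeff_2 n r s * elem_part [n - 2, 2] \<alpha>))"
    using assms by (rule chrom_qsf_inc_edge)
  then have X_sum: "?X = (\<lambda>\<alpha>. \<Sum>lam\<in>?L. p lam * elem_part lam \<alpha>)"
    by (simp add: p_def distrib_left mult.assoc add.assoc)
  have partition: "is_partition lam" if "lam \<in> ?L" for lam
    using that assms(1-3) by (auto simp: is_partition_def)
  have unimodal: "palindromic_unimodal ?d (p lam)" for lam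
    unfolding p_def
    by (intro palindromic_unimodal_qfact_mult) (simp only: palindromic_unimodal_elem_coeff_0[OF assms(1-3)]
        palindromic_unimodal_elem_coeff_1[OF assms(1-3)] palindromic_unimodal_elem_coeff_2[OF assms(1-3)]
        simp_thms split: if_split)
  have "of_nat ?d = 2 * ?c"
    using assms(1-3) by (rule twice_center_of_symmetry)
  from e_positive_unimodal_sum[OF _ partition unimodal X_sum this] X show ?thesis
    unfolding elem_coeff_0_def elem_coeff_1_def elem_coeff_2_def t_def by simp
qed

end
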